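(* Let the family of random variables $\{U_n\}_{n\in\mathbb N}$ be weakly relatively compact. Assume that the coherency condition holds: for any $T\in(0,\infty)$, $$\lim_{n\to\infty}\mathsf{E}\sup_{\|\mathbf t\|\le T}\big|h_{n,N_n}(\mathbf t)-h(\mathbf t)\big|=0 .$$ Let $\mathbf Z$ be an $\mathbb R^m$-valued random vector. Then $$\mathbf Z_n\Longrightarrow\mathbf Z\qquad(n\to\infty)$$ if and only if there exists a weakly relatively compact sequence of random vectors $\mathbf W_n^*=(U_n^*,(\mathbf V_n^* )^\top)^\top\in\mathcal W(\mathbf Z|\mathbf Y)$, $n\in\mathbb N$, such that $$\lim_{n\to\infty}\Lambda(\mathbf W_n^*,\mathbf W_n)=0 .$$
   Context: Fix $m\in\mathbb N=\{1,2,\dots\}$. $\langle\cdot,\cdot\rangle$ and $\|\cdot\|$ are the Euclidean scalar product and norm in $\mathbb R^m$; $\Longrightarrow$ is convergence in distribution. A family of random vectors is weakly relatively compact if each sequence of its elements contains a weakly convergent subsequence (equivalently, in finite dimension, the family is tight). Random vectors are considered on one probability space, assumed rich enough to carry any random vectors needed (only their distributions matter below). Let $\{\mathbf S_{n,k}\}_{n,k\in\mathbb N}$ be a double array of $\mathbb R^m$-valued random vectors (no independence within rows is assumed). Let $\mathbf a_{n,k}\in\mathbb R^m$ be non-random vectors and $b_{n,k}>0$ non-random real numbers, $n,k\in\mathbb N$. Put $\mathbf Y_{n,k}=b_{n,k}^{-1}(\mathbf S_{n,k}-\mathbf a_{n,k})$ and let $h_{n,k}$ be the characteristic function of $\mathbf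 Y_{n,k}$. Let $\{N_n\}_{n\in\mathbb N}$ be random variables with values in $\mathbb N$ such that for all $n,k\in\mathbb N$ the random variable $N_n$ and the random vector $\mathbf S_{n,k}$ are independent. Let $\mathbf c_n\in\mathbb R^m$ and $d_n>0$, $n\in\mathbb N$, be non-random. Put $$\mathbf Z_n=d_n^{-1}(\mathbf S_{n,N_n}-\mathbf c_n),\quad U_n=d_n^{-1}b_{n,N_n},\quad \mathbf V_n=d_n^{-1}(\mathbf a_{n,N_n}-\mathbf c_n),\quad \mathbf W_n=(U_n,\mathbf V_n^\top)^\top\in\mathbb R^{m+1}.$$ $\mathbf Y$ is an $\mathbb R^m$-valued random vector with characteristic function $h$. In the coherency condition, $h_{n,N_n}(\mathbf t)$ denotes the random variable obtained by substituting $k=N_n$ into $h_{n,k}(\mathbf t)$. For random vectors $\mathbf Z$ (with characteristic function $f$) and $\mathbf Y$ (with characteristic function $h$), $\mathcal W(\mathbf Z|\mathbf Y)$ is the set of all $(m+1)$-dimensional random vectors $\mathbf W=(U,\mathbf V^\top)^\top$, with $U\in\mathbb R$ and $\mathbf V\in\mathbb R^m$, such that $\mathsf P(U\ge 0)=1$ and $$f(\mathbf t)=\mathsf E\, h(U\mathbf t)e^{i\langle\mathbf t,\mathbf V\rangle},\qquad \mathbf t\in\mathbb R^m .$$ $\Lambda(\mathbf X_1,\mathbf X_2)$ is any probability metric (a function of the distributions of $\mathbf X_1,\mathbf X_2$) which metrizes weak convergence in the space of $(m+1)$-dimensional random vectors, e.g. the Lévy–Prokhorov metric. *)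

theory Defs
  imports "HOL-Probability.Probability"
begin

text \<open>
  The Borel probability measures on a space \<open>'b\<close> are the elements of
  \<open>space (prob_algebra borel)\<close>. The library notions \<open>char\<close>, \<open>weak_conv_m\<close> and \<open>tight\<close> are
  restricted to measures on the real line; the notions below cover Euclidean spaces.
  The space of the vectors (U, V) of dimension m + 1 is rendered as the Euclidean space
  \<open>real \<times> (real ^ 'm)\<close>.
\<close>

definition char_fun :: "'b::real_inner measure \<Rightarrow> 'b \<Rightarrow> complex" where
  "char_fun \<mu> t = (CLINT x|\<mu>. iexp (t \<bullet> x))"

definition weakly_converges ::
    "(nat \<Rightarrow> 'b::topological_space measure) \<Rightarrow> 'b measure \<Rightarrow> bool" where
  "weakly_converges \<mu>s \<mu> \<longleftrightarrow>
     (\<forall>f::'b \<Rightarrow> real. continuous_on UNIV f \<and> bounded (range f) \<longrightarrow>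
        (\<lambda>n. LINT x|\<mu>s n. f x) \<longlonglongrightarrow> (LINT x|\<mu>. f x))"

definition converges_in_distribution ::
    "'a measure \<Rightarrow> (nat \<Rightarrow> 'a \<Rightarrow> 'b::topological_space) \<Rightarrow> ('a \<Rightarrow> 'b) \<Rightarrow> bool" where
  "converges_in_distribution M Xs X \<longleftrightarrow>
     weakly_converges (\<lambda>n. distr M borel (Xs n)) (distr M borel X)"

text \<open>
  Sequences \<open>s\<close> of members of the family may repeat indices and need not be monotone. The limit
  law must be a probability measure (no loss of mass), but need not be the law of a member.
\<close>

definition weakly_relatively_compact ::
    "'a measure \<Rightarrow> ('i \<Rightarrow> 'a \<Rightarrow> 'b::topological_space) \<Rightarrow> bool" where
  "weakly_relatively_compact M X \<longleftrightarrow>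
     (\<forall>s::nat \<Rightarrow> 'i. \<exists>r::nat \<Rightarrow> nat. strict_mono r \<and>
        (\<exists>\<mu>\<in>space (prob_algebra borel).
           weakly_converges (\<lambda>j. distr M borel (X (s (r j)))) \<mu>))"

definition metrizes_weak_convergence ::
    "('b::topological_space measure \<Rightarrow> 'b measure \<Rightarrow> real) \<Rightarrow> bool" where
  "metrizes_weak_convergence \<Lambda> \<longleftrightarrow>
     Metric_space (space (prob_algebra borel)) \<Lambda> \<and>
     (\<forall>\<mu>s. \<forall>\<mu>\<in>space (prob_algebra borel).
        (\<forall>n. \<mu>s n \<in> space (prob_algebra borel)) \<longrightarrow>
        ((\<lambda>n. \<Lambda> (\<mu>s n) \<mu>) \<longlonglongrightarrow> 0 \<longleftrightarrow> weakly_converges \<mu>s \<mu>))"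

definition mixing_vectors ::
    "'a measure \<Rightarrow> ('a \<Rightarrow> 'b::euclidean_space) \<Rightarrow> ('a \<Rightarrow> 'b) \<Rightarrow> ('a \<Rightarrow> real \<times> 'b) set" where
  "mixing_vectors M Z Y =
     {W \<in> borel_measurable M.
        measure M {\<omega> \<in> space M. fst (W \<omega>) \<ge> 0} = 1 \<and>
        (\<forall>t. char_fun (distr M borel Z) t =
           (CLINT \<omega>|M. char_fun (distr M borel Y) (fst (W \<omega>) *\<^sub>R t) * iexp (t \<bullet> snd (W \<omega>))))}"

text \<open>The probability space carries a random element with any prescribed Borel law on \<open>'b\<close>.\<close>

definition rich_for :: "'a measure \<Rightarrow> 'b::topological_space itself \<Rightarrow> bool" where
  "rich_for M _ \<longleftrightarrow>
     (\<forall>\<mu>::'b measure. \<mu> \<in> space (prob_algebra borel) \<longrightarrow>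
        (\<exists>X\<in>borel_measurable M. distr M borel X = \<mu>))"

text \<open>
  Independence of the generated sigma-algebras; the library's \<open>indep_var\<close> requires both
  variables to take values in the same type.
\<close>

definition independent_rvs ::
    "'a measure \<Rightarrow> 'b measure \<Rightarrow> ('a \<Rightarrow> 'b) \<Rightarrow> 'c measure \<Rightarrow> ('a \<Rightarrow> 'c) \<Rightarrow> bool" where
  "independent_rvs M A X B X' \<longleftrightarrow>
     prob_space.indep_set M
       (sets (vimage_algebra (space M) X A)) (sets (vimage_algebra (space M) X' B))"

end

theory Submission
  imports Defs
begin

text \<open>
  The index \<open>N n\<close> is independent of each \<open>S n k\<close>, so conditioning on it gives
    \<open>E exp(i t \<bullet> Z_n) = E h_{n,N_n}(U_n t) exp(i t \<bullet> V_n)\<close>.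
  As \<open>U_n\<close> is tight, the points \<open>U_n t\<close> stay in a fixed ball up to a small probability, and there
  coherency permits replacing \<open>h_{n,N_n}\<close> by \<open>h\<close> (\<open>mixture_kernel_coherent_limit\<close>). Hence, with
  the bounded continuous function \<open>(u, v) \<mapsto> h(u t) exp(i t \<bullet> v)\<close>, called \<open>mixture_kernel h t\<close>,
  convergence of \<open>Z_n\<close> to \<open>Z\<close> in distribution is equivalent to convergence of the integral of this
  function under the law of \<open>W_n\<close> to the characteristic function of \<open>Z\<close> at \<open>t\<close>, for every \<open>t\<close>; and
  the members of \<open>mixing_vectors M Z Y\<close> are the vectors with almost surely nonnegative first
  component whose law gives this integral exactly that value.

  If \<open>W_star\<close> is given, then along a subsequence on which it converges weakly, \<open>W_n\<close> has the same
  weak limit. The integrals under the laws of \<open>W_star\<close> are constant, so the integrals under the laws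
  of \<open>W_n\<close> converge to this constant.

  Conversely, let \<open>Z_n\<close> converge. The integral above is the characteristic function of
  \<open>U_n Y' + V_n\<close> with \<open>Y'\<close> a copy of \<open>Y\<close> that is independent of \<open>W_n\<close>. By Levy's continuity
  theorem \<open>U_n Y' + V_n\<close> is tight; so are \<open>U_n\<close> and \<open>U_n Y'\<close>, and therefore \<open>V_n\<close> and \<open>W_n\<close>
  (\<open>uniformly_tight_mixing_laws\<close>). Every subsequence of \<open>W_n\<close> then has a weakly convergent
  subsequence, whose limit is the law of a mixing vector because the integrals converge and \<open>U_n > 0\<close>.
  Hence the distance from the law of \<open>W_n\<close> to the laws of mixing vectors tends to 0, and
  \<open>W_star n\<close> can be taken to attain this distance up to \<open>1 / (n + 1)\<close>.

  Two tools on Euclidean spaces are reduced to their counterparts on the real line. Prokhorov's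
  theorem: there is a continuous surjection from the line (a space-filling curve) with a Borel section
  that is bounded on bounded sets; tight laws are lifted along the section, Helly's theorem selects a
  subsequence, and the continuous map carries the limit back. Uniqueness of characteristic
  functions: the one-dimensional theorem is applied to one coordinate at a time under suitable positive
  weights. Together they give Levy's continuity theorem.
\<close>

section \<open>A continuous map of the line onto a Euclidean space\<close>

text \<open>
  The distance from \<open>t\<close> to the nearest even integer: it has period 2 and is the identity on \<open>[0, 1]\<close>.
\<close>

definition triangle_wave :: "real \<Rightarrow> real" where
  "triangle_wave t = arccos (cos (pi * t)) / pi"

text \<open>
  The following functions build Schoenberg's curve. The wave below is constantly 0 on \<open>[0, 1/3]\<close> and
  constantly 1 on \<open>[2/3, 1]\<close>, so on the Cantor set it reads off the first ternary digit (as 0 or 1);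
  by periodicity, its value at \<open>3 ^ k * t\<close> is the digit at position \<open>k\<close>.
\<close>

definition ternary_digit_wave :: "real \<Rightarrow> real" where
  "ternary_digit_wave t = min 1 (max 0 (3 * triangle_wave t - 1))"

definition cantor_point :: "(nat \<Rightarrow> real) \<Rightarrow> real" where
  "cantor_point \<beta> = (\<Sum>j. 2 * \<beta> j / 3 ^ Suc j)"

text \<open>
  The binary digit of \<open>u \<in> [0, 1)\<close> at position \<open>k\<close>, written by floors so that it is visibly a Borel
  function of \<open>u\<close> and its weighted sums telescope.
\<close>

definition bit_at :: "nat \<Rightarrow> real \<Rightarrow> real" where
  "bit_at k u = real_of_int \<lfloor>2 ^ Suc k * u\<rfloor> - 2 * real_of_int \<lfloor>2 ^ k * u\<rfloor>"

text \<open>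
  For \<open>t\<close> in the Cantor set, the number whose binary digits are the ternary digits of \<open>t\<close> (as 0 or 1)
  at the even positions if \<open>i = 0\<close> and at the odd positions if \<open>i = 1\<close>: the two coordinates of a
  curve that fills the unit square.
\<close>

definition curve_coord :: "nat \<Rightarrow> real \<Rightarrow> real" where
  "curve_coord i t = (\<Sum>k. ternary_digit_wave (3 ^ (2 * k + i) * t) / 2 ^ Suc k)"

lemma triangle_wave_periodic: "triangle_wave (t + 2 * of_int n) = triangle_wave t"
proof -
  have "pi * (t + 2 * of_int n) = pi * t + 2 * pi * of_int n"
    by (simp add: algebra_simps)
  then show ?thesis
    by (simp add: triangle_wave_def cos_add)
qed

lemma triangle_wave_id: "0 \<le> t \<Longrightarrow> t \<le> 1 \<Longrightarrow> triangle_wave t = t"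
  by (simp add: triangle_wave_def arccos_cos)

lemma continuous_triangle_wave: "continuous_on UNIV triangle_wave"
  unfolding triangle_wave_def by (intro continuous_intros) auto

lemma continuous_ternary_digit_wave: "continuous_on UNIV ternary_digit_wave"
  unfolding ternary_digit_wave_def
  by (intro continuous_intros continuous_on_compose2[OF continuous_triangle_wave]) auto

lemma ternary_digit_wave_bounds: "0 \<le> ternary_digit_wave t" "ternary_digit_wave t \<le> 1"
  by (auto simp: ternary_digit_wave_def)

lemma ternary_digit_wave_periodic:
  "ternary_digit_wave (t + 2 * of_int n) = ternary_digit_wave t"
  by (simp add: ternary_digit_wave_def triangle_wave_periodic)

lemma sums_ternary: "(\<lambda>j. 2 / 3 ^ Suc j :: real) sums 1"
  using sums_mult[OF geometric_sums[of "1/3::real"], of "2/3"]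
  by (simp add: power_divide)

lemma summable_cantor:
  assumes "\<And>j. \<beta> j \<in> {0, 1}"
  shows "summable (\<lambda>j. 2 * \<beta> j / 3 ^ Suc j :: real)"
proof (rule summable_comparison_test')
  show "norm (2 * \<beta> n / 3 ^ Suc n) \<le> 2 / 3 ^ Suc n" if "n \<ge> 0" for n
    using assms[of n] by auto
qed (use sums_ternary in \<open>auto simp: sums_iff\<close>)

lemma cantor_point_bounds:
  assumes "\<And>j. \<beta> j \<in> {0, 1}"
  shows "0 \<le> cantor_point \<beta>" "cantor_point \<beta> \<le> 1"
proof -
  have b: "0 \<le> \<beta> j" "\<beta> j \<le> 1" for j
    using assms[of j] by auto
  show "0 \<le> cantor_point \<beta>"
    unfolding cantor_point_def using b by (intro suminf_nonneg summable_cantor assms) auto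
  have "cantor_point \<beta> \<le> (\<Sum>j. 2 / 3 ^ Suc j)"
    unfolding cantor_point_def
    by (intro suminf_le summable_cantor assms divide_right_mono)
       (use b sums_ternary in \<open>auto simp: sums_iff\<close>)
  then show "cantor_point \<beta> \<le> 1"
    using sums_ternary by (simp add: sums_iff)
qed

lemma cantor_point_shift:
  assumes "\<And>j. \<beta> j \<in> {0, 1}"
  shows "3 * cantor_point \<beta> = 2 * \<beta> 0 + cantor_point (\<lambda>j. \<beta> (Suc j))"
proof -
  have "cantor_point \<beta> = (\<Sum>j. 2 * \<beta> (Suc j) / 3 ^ Suc (Suc j)) + 2 * \<beta> 0 / 3"
    unfolding cantor_point_def using suminf_split_head[OF summable_cantor[of \<beta>, OF assms]] by simp
  also have "(\<Sum>j. 2 * \<beta> (Suc j) / 3 ^ Suc (Suc j)) = cantor_point (\<lambda>j. \<beta> (Suc j)) / 3"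
    unfolding cantor_point_def
    using suminf_divide[OF summable_cantor[of "\<lambda>j. \<beta> (Suc j)"], of 3] assms by (simp add: mult.commute)
  finally show ?thesis by simp
qed

text \<open>
  Multiplication by 3 shifts the digits and adds the even integer \<open>2 * \<beta> 0\<close>, which the period
  removes. After \<open>k\<close> shifts, digit \<open>k\<close> comes first, and it decides in which outer third of
  \<open>[0, 1]\<close> the point lies.
\<close>

lemma ternary_digit_wave_cantor_point:
  assumes "\<And>j. \<beta> j \<in> {0, 1}"
  shows "ternary_digit_wave (3 ^ k * cantor_point \<beta>) = \<beta> k"
  using assms
proof (induction k arbitrary: \<beta>)
  case 0
  define r where "r = cantor_point (\<lambda>j. \<beta> (Suc j))"
  have r: "0 \<le> r" "r \<le> 1"
    unfolding r_def using cantor_point_bounds[of "\<lambda>j. \<beta> (Suc j)"] 0 by auto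
  have c: "cantor_point \<beta> = (2 * \<beta> 0 + r) / 3"
    using cantor_point_shift[of \<beta>] 0 by (simp add: r_def)
  have "triangle_wave (cantor_point \<beta>) = cantor_point \<beta>"
    using cantor_point_bounds[of \<beta>] 0 by (intro triangle_wave_id) auto
  moreover have "\<beta> 0 = 0 \<or> \<beta> 0 = 1"
    using 0[of 0] by auto
  ultimately show ?case
    using r by (auto simp: ternary_digit_wave_def c)
next
  case (Suc k)
  have "\<beta> 0 = 0 \<or> \<beta> 0 = 1"
    using Suc.prems[of 0] by auto
  then obtain z :: int where z: "\<beta> 0 = of_int z"
    by (metis of_int_0 of_int_1)
  have "3 ^ Suc k * cantor_point \<beta> = 3 ^ k * (3 * cantor_point \<beta>)"
    by simp
  also have "\<dots> = 3 ^ k * cantor_point (\<lambda>j. \<beta> (Suc j)) + 2 * of_int (3 ^ k * z)"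
    using cantor_point_shift[of \<beta>] Suc.prems z by (simp add: algebra_simps)
  finally show ?case
    using Suc.IH[of "\<lambda>j. \<beta> (Suc j)"] Suc.prems by (simp only: ternary_digit_wave_periodic)
qed

lemma bit_at_01: "bit_at k u \<in> {0, 1}"
proof -
  define x where "x = 2 ^ k * u"
  have "\<lfloor>2 * x\<rfloor> = 2 * \<lfloor>x\<rfloor> \<or> \<lfloor>2 * x\<rfloor> = 2 * \<lfloor>x\<rfloor> + 1"
    by linarith
  moreover have "bit_at k u = of_int \<lfloor>2 * x\<rfloor> - 2 * of_int \<lfloor>x\<rfloor>"
    by (simp add: bit_at_def x_def mult.assoc)
  ultimately show ?thesis
    by auto
qed

lemma bit_at_sums:
  assumes "0 \<le> u" "u < 1"
  shows "(\<lambda>k. bit_at k u / 2 ^ Suc k) sums u"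
proof -
  have partial: "(\<Sum>k<n. bit_at k u / 2 ^ Suc k) = of_int \<lfloor>2 ^ n * u\<rfloor> / 2 ^ n" for n
  proof (induction n)
    case 0
    have "\<lfloor>u\<rfloor> = 0" using assms by linarith
    then show ?case by simp
  qed (simp add: bit_at_def field_simps)
  have bound: "norm ((\<Sum>k<n. bit_at k u / 2 ^ Suc k) - u) \<le> (1/2) ^ n" for n
  proof -
    have "\<bar>of_int \<lfloor>2 ^ n * u\<rfloor> - 2 ^ n * u\<bar> \<le> 1" by linarith
    moreover have "of_int \<lfloor>2 ^ n * u\<rfloor> / 2 ^ n - u = (of_int \<lfloor>2 ^ n * u\<rfloor> - 2 ^ n * u) / 2 ^ n"
      by (simp add: field_simps)
    ultimately show ?thesis
      unfolding partial by (simp add: abs_divide power_divide divide_right_mono)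
  qed
  have "(\<lambda>n. (1/2 :: real) ^ n) \<longlonglongrightarrow> 0"
    by (intro LIMSEQ_realpow_zero) auto
  then have "(\<lambda>n. (\<Sum>k<n. bit_at k u / 2 ^ Suc k) - u) \<longlonglongrightarrow> 0"
    by (rule Lim_null_comparison[rotated]) (use bound in auto)
  then show ?thesis
    unfolding sums_def by (simp add: LIM_zero_iff)
qed

lemma continuous_curve_coord: "continuous_on UNIV (curve_coord i)"
proof -
  have "uniform_limit UNIV (\<lambda>n t. \<Sum>k<n. ternary_digit_wave (3 ^ (2 * k + i) * t) / 2 ^ Suc k)
          (\<lambda>t. \<Sum>k. ternary_digit_wave (3 ^ (2 * k + i) * t) / 2 ^ Suc k) sequentially"
  proof (rule Weierstrass_m_test)
    show "norm (ternary_digit_wave (3 ^ (2 * k + i) * t) / 2 ^ Suc k) \<le> (1/2) ^ k" for k t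
    proof -
      have "ternary_digit_wave (3 ^ (2 * k + i) * t) / 2 ^ Suc k \<le> 1 / 2 ^ k"
        using ternary_digit_wave_bounds by (intro frac_le) auto
      then show ?thesis
        using ternary_digit_wave_bounds[of "3 ^ (2 * k + i) * t"] by (simp add: power_one_over)
    qed
  qed (simp add: summable_geometric)
  then show ?thesis
    unfolding curve_coord_def
    by (rule uniform_limit_theorem[rotated])
       (auto intro!: always_eventually continuous_intros
          continuous_on_compose2[OF continuous_ternary_digit_wave])
qed

text \<open>
  The curve fills the unit square while \<open>t\<close> runs through \<open>[2 s, 2 s + 1]\<close>, for each integer \<open>s\<close>.
  The continuous factor \<open>(t - triangle_wave t) / 2\<close> equals \<open>s\<close> on this interval, so the scaled and
  centred curve fills the square \<open>[- s, s]\<^sup>2\<close> there, and the whole plane in total. A section chooses for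
  \<open>w\<close> an integer \<open>s\<close> larger than the absolute values of its
  coordinates and then the Cantor point that interleaves the
  binary digits of the rescaled coordinates.
\<close>

lemma continuous_real_to_plane_with_borel_section:
  obtains p\<^sub>1 p\<^sub>2 :: "real \<Rightarrow> real" and \<psi> :: "real \<times> real \<Rightarrow> real"
  where "continuous_on UNIV p\<^sub>1" "continuous_on UNIV p\<^sub>2" "\<psi> \<in> borel_measurable borel"
    and "\<And>u v. p\<^sub>1 (\<psi> (u, v)) = u" "\<And>u v. p\<^sub>2 (\<psi> (u, v)) = v"
    and "\<And>K. \<exists>L. \<forall>u v. \<bar>u\<bar> \<le> K \<longrightarrow> \<bar>v\<bar> \<le> K \<longrightarrow> \<bar>\<psi> (u, v)\<bar> \<le> L"
proof -
  define p where "p i t = (t - triangle_wave t) / 2 * (2 * curve_coord i t - 1)" for i t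
  define size :: "real \<times> real \<Rightarrow> int" where "size = (\<lambda>w. \<lceil>\<bar>fst w\<bar> + \<bar>snd w\<bar>\<rceil> + 1)"
  define unit where "unit x w = (x / of_int (size w) + 1) / 2" for x :: real and w :: "real \<times> real"
  define \<beta> where "\<beta> w j =
    (if even j then bit_at (j div 2) (unit (fst w) w) else bit_at (j div 2) (unit (snd w) w))"
    for w :: "real \<times> real" and j
  define \<psi> where "\<psi> w = cantor_point (\<beta> w) + 2 * of_int (size w)" for w
  have \<beta>01: "\<beta> w j \<in> {0, 1}" for w j
    unfolding \<beta>_def using bit_at_01 by auto
  have digit: "ternary_digit_wave (3 ^ k * \<psi> w) = \<beta> w k" for k w
  proof -
    have "3 ^ k * \<psi> w = 3 ^ k * cantor_point (\<beta> w) + 2 * of_int (3 ^ k * size w)"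
      by (simp add: \<psi>_def algebra_simps)
    then show ?thesis
      using ternary_digit_wave_cantor_point[of "\<beta> w", OF \<beta>01]
      by (simp only: ternary_digit_wave_periodic)
  qed
  have scale: "(\<psi> w - triangle_wave (\<psi> w)) / 2 = of_int (size w)" for w
    using cantor_point_bounds[of "\<beta> w", OF \<beta>01]
    by (simp add: \<psi>_def triangle_wave_periodic triangle_wave_id)
  have unit01: "0 \<le> unit x w \<and> unit x w < 1 \<and> of_int (size w) * (2 * unit x w - 1) = x"
    if "\<bar>x\<bar> \<le> \<bar>fst w\<bar> + \<bar>snd w\<bar>" for x w
  proof -
    have "\<bar>x\<bar> < of_int (size w)"
      using that unfolding size_def by linarith
    then show ?thesis
      unfolding unit_def by (auto simp: field_simps)
  qed
  have p0: "p 0 (\<psi> w) = fst w" for w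
  proof -
    have "curve_coord 0 (\<psi> w) = unit (fst w) w"
      unfolding curve_coord_def digit \<beta>_def
      using bit_at_sums[of "unit (fst w) w"] unit01[of "fst w" w] by (simp add: sums_iff)
    then show ?thesis
      unfolding p_def scale using unit01[of "fst w" w] by simp
  qed
  have p1: "p 1 (\<psi> w) = snd w" for w
  proof -
    have "curve_coord 1 (\<psi> w) = unit (snd w) w"
      unfolding curve_coord_def digit \<beta>_def
      using bit_at_sums[of "unit (snd w) w"] unit01[of "snd w" w] by (simp add: sums_iff)
    then show ?thesis
      unfolding p_def scale using unit01[of "snd w" w] by simp
  qed
  show thesis
  proof (rule that[of "p 0" "p 1" \<psi>])
    show "continuous_on UNIV (p 0)" "continuous_on UNIV (p 1)"
      unfolding p_def
      by (auto intro!: continuous_intros continuous_triangle_wave continuous_curve_coord)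
    have [measurable]: "(fst :: real \<times> real \<Rightarrow> real) \<in> borel_measurable borel"
      "(snd :: real \<times> real \<Rightarrow> real) \<in> borel_measurable borel"
      by (intro borel_measurable_continuous_onI continuous_intros)+
    show "\<psi> \<in> borel_measurable borel"
      unfolding \<psi>_def cantor_point_def \<beta>_def bit_at_def unit_def size_def
      by (simp only: of_int_add of_int_1) measurable
    show "p 0 (\<psi> (u, v)) = u" "p 1 (\<psi> (u, v)) = v" for u v
      using p0[of "(u, v)"] p1[of "(u, v)"] by simp_all
    show "\<exists>L. \<forall>u v. \<bar>u\<bar> \<le> K \<longrightarrow> \<bar>v\<bar> \<le> K \<longrightarrow> \<bar>\<psi> (u, v)\<bar> \<le> L" for K
    proof (intro exI allI impI)
      fix u v :: real assume "\<bar>u\<bar> \<le> K" "\<bar>v\<bar> \<le> K"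
      moreover have "of_int (size (u, v)) \<le> \<bar>u\<bar> + \<bar>v\<bar> + 2" "0 \<le> size (u, v)"
        unfolding size_def by (simp_all, linarith+)
      ultimately show "\<bar>\<psi> (u, v)\<bar> \<le> 4 * K + 5"
        unfolding \<psi>_def using cantor_point_bounds[of "\<beta> (u, v)", OF \<beta>01] by simp
    qed
  qed
qed

text \<open>
  By induction on the set of coordinates: composing with a map of the line onto the plane splits the
  parameter into one that serves the coordinates treated so far and one that is the new coordinate.
\<close>

lemma continuous_real_to_subspace_with_borel_section:
  fixes A :: "'b::euclidean_space set"
  assumes "A \<subseteq> Basis"
  shows "\<exists>(\<phi> :: real \<Rightarrow> 'b) \<psi>. continuous_on UNIV \<phi> \<and> \<psi> \<in> borel_measurable borel \<and>
           (\<forall>x. \<forall>i\<in>A. \<phi> (\<psi> x) \<bullet> i = x \<bullet> i) \<and>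
           (\<forall>K. \<exists>L. \<forall>x. norm x \<le> K \<longrightarrow> \<bar>\<psi> x\<bar> \<le> L)"
proof -
  obtain p\<^sub>1 p\<^sub>2 :: "real \<Rightarrow> real" and \<pi> :: "real \<times> real \<Rightarrow> real"
    where p: "continuous_on UNIV p\<^sub>1" "continuous_on UNIV p\<^sub>2" "\<pi> \<in> borel_measurable borel"
      "\<And>u v. p\<^sub>1 (\<pi> (u, v)) = u" "\<And>u v. p\<^sub>2 (\<pi> (u, v)) = v"
      "\<And>K. \<exists>L. \<forall>u v. \<bar>u\<bar> \<le> K \<longrightarrow> \<bar>v\<bar> \<le> K \<longrightarrow> \<bar>\<pi> (u, v)\<bar> \<le> L"
    by (rule continuous_real_to_plane_with_borel_section) (rule that; assumption)
  have "finite A"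
    using assms finite_Basis finite_subset by blast
  then show ?thesis
    using assms
  proof (induction A)
    case empty
    show ?case
      by (rule exI[of _ "\<lambda>_. 0"], rule exI[of _ "\<lambda>_. 0"]) auto
  next
    case (insert b A)
    then obtain \<phi> :: "real \<Rightarrow> 'b" and \<psi>
      where \<phi>: "continuous_on UNIV \<phi>" "\<psi> \<in> borel_measurable borel"
        "\<And>x i. i \<in> A \<Longrightarrow> \<phi> (\<psi> x) \<bullet> i = x \<bullet> i"
        "\<And>K. \<exists>L. \<forall>x. norm x \<le> K \<longrightarrow> \<bar>\<psi> x\<bar> \<le> L"
      by auto
    \<comment> \<open>The correction along \<open>b\<close> makes \<open>p\<^sub>2 t\<close> the coordinate of \<open>\<phi>' t\<close> in direction \<open>b\<close>.\<close>
    define \<phi>' where "\<phi>' t = \<phi> (p\<^sub>1 t) + (p\<^sub>2 t - \<phi> (p\<^sub>1 t) \<bullet> b) *\<^sub>R b" for t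
    define \<psi>' where "\<psi>' x = \<pi> (\<psi> x, x \<bullet> b)" for x
    have b: "b \<in> Basis" "\<And>i. i \<in> A \<Longrightarrow> b \<bullet> i = 0"
      using insert by (auto intro!: inner_not_same_Basis)
    show ?case
    proof (intro exI[of _ \<phi>'] exI[of _ \<psi>'] conjI allI ballI)
      show "continuous_on UNIV \<phi>'"
        unfolding \<phi>'_def
        by (intro continuous_intros continuous_on_compose2[OF \<phi>(1)] p(1,2)) auto
      show "\<psi>' \<in> borel_measurable borel"
        unfolding \<psi>'_def
        by (rule measurable_compose[OF _ p(3)]) (use \<phi>(2) in measurable)
      show "\<phi>' (\<psi>' x) \<bullet> i = x \<bullet> i" if "i \<in> insert b A" for x i
        using that b \<phi>(3) by (auto simp: \<phi>'_def \<psi>'_def p(4,5) inner_add_left inner_diff_left)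
      fix K :: real
      obtain L1 where L1: "\<And>x. norm x \<le> K \<Longrightarrow> \<bar>\<psi> x\<bar> \<le> L1"
        using \<phi>(4) by blast
      obtain L2 where L2: "\<And>u v. \<bar>u\<bar> \<le> max L1 K \<Longrightarrow> \<bar>v\<bar> \<le> max L1 K \<Longrightarrow> \<bar>\<pi> (u, v)\<bar> \<le> L2"
        using p(6) by blast
      show "\<exists>L. \<forall>x. norm x \<le> K \<longrightarrow> \<bar>\<psi>' x\<bar> \<le> L"
      proof (intro exI[of _ L2] allI impI)
        fix x :: 'b assume x: "norm x \<le> K"
        have "\<bar>x \<bullet> b\<bar> \<le> K"
          using Basis_le_norm[OF b(1), of x] x by linarith
        then show "\<bar>\<psi>' x\<bar> \<le> L2"
          unfolding \<psi>'_def using L1[OF x] by (intro L2) auto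
      qed
    qed
  qed
qed

lemma continuous_real_onto_euclidean_with_borel_section:
  obtains \<phi> :: "real \<Rightarrow> 'b::euclidean_space" and \<psi> :: "'b \<Rightarrow> real"
  where "continuous_on UNIV \<phi>" "\<psi> \<in> borel_measurable borel" "\<And>x. \<phi> (\<psi> x) = x"
    and "\<And>K. \<exists>L. \<forall>x. norm x \<le> K \<longrightarrow> \<bar>\<psi> x\<bar> \<le> L"
proof -
  obtain \<phi> :: "real \<Rightarrow> 'b" and \<psi>
    where \<phi>: "continuous_on UNIV \<phi>" "\<psi> \<in> borel_measurable borel"
      "\<And>x i. i \<in> Basis \<Longrightarrow> \<phi> (\<psi> x) \<bullet> i = x \<bullet> i"
      "\<And>K. \<exists>L. \<forall>x. norm x \<le> K \<longrightarrow> \<bar>\<psi> x\<bar> \<le> L"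
    using continuous_real_to_subspace_with_borel_section[of "Basis :: 'b set"] by blast
  show thesis
    by (rule that[of \<phi> \<psi>]) (use \<phi> in \<open>auto intro: euclidean_eqI\<close>)
qed

section \<open>Tightness and weak compactness\<close>

lemma in_prob_algebra_borel_iff:
  "\<mu> \<in> space (prob_algebra borel) \<longleftrightarrow> prob_space \<mu> \<and> sets \<mu> = sets borel"
  by (auto simp: space_prob_algebra)

lemma distr_in_prob_algebra:
  assumes "\<mu> \<in> space (prob_algebra A)" "f \<in> measurable A B"
  shows "distr \<mu> B f \<in> space (prob_algebra B)"
  using assms by (auto simp: space_prob_algebra cong: measurable_cong_sets intro!: prob_space.prob_space_distr)

definition uniformly_tight :: "('i \<Rightarrow> 'b::real_normed_vector measure) \<Rightarrow> bool" where
  "uniformly_tight \<mu> \<longleftrightarrow> (\<forall>\<epsilon>>0. \<exists>K. \<forall>i. measure (\<mu> i) {x. K < norm x} < \<epsilon>)"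

text \<open>
  Relative compactness speaks of arbitrary, possibly repeating, index sequences. This dichotomy reduces
  them to constant ones and to genuine subsequences.
\<close>

lemma subseq_constant_or_strict_mono:
  fixes s :: "nat \<Rightarrow> nat"
  obtains r :: "nat \<Rightarrow> nat" where "strict_mono r" "(\<exists>k. \<forall>j. s (r j) = k) \<or> strict_mono (s \<circ> r)"
proof (cases "\<exists>k. infinite {j. s j = k}")
  case True
  then obtain k where "infinite {j. s j = k}" ..
  from infinite_enumerate[OF this] show thesis
    using that by blast
next
  case False
  have "\<exists>r. \<forall>n. r n < r (Suc n) \<and> s (r n) < s (r (Suc n))"
  proof -
    have "\<exists>j. i < j \<and> s i < s j" for i
    proof (rule ccontr)
      assume "\<not> ?thesis"
      then have "UNIV \<subseteq> {..i} \<union> (\<Union>k\<le>s i. {j. s j = k})"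
        by (auto simp: not_less not_le)
      moreover have "finite ({..i} \<union> (\<Union>k\<le>s i. {j. s j = k}))"
        using False by auto
      ultimately show False
        using finite_subset infinite_UNIV_nat by blast
    qed
    then obtain nx where "\<And>i. i < nx i \<and> s i < s (nx i)"
      by metis
    then show ?thesis
      by (intro exI[of _ "\<lambda>n. (nx ^^ n) 0"]) simp
  qed
  then show thesis
    using that by (auto simp: strict_mono_Suc_iff)
qed

lemma tendsto_if_subseqs:
  fixes X :: "nat \<Rightarrow> 'a::metric_space"
  assumes "\<And>s :: nat \<Rightarrow> nat. strict_mono s \<Longrightarrow> \<exists>r. strict_mono r \<and> (\<lambda>j. X (s (r j))) \<longlonglongrightarrow> L"
  shows "X \<longlonglongrightarrow> L"
proof (rule ccontr)
  assume "\<not> ?thesis"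
  then obtain \<epsilon> where \<epsilon>: "\<epsilon> > 0" "\<And>N. \<exists>n\<ge>N. \<not> dist (X n) L < \<epsilon>"
    unfolding lim_sequentially by blast
  then have "infinite {n. \<not> dist (X n) L < \<epsilon>}"
    unfolding infinite_nat_iff_unbounded_le by blast
  from infinite_enumerate[OF this] obtain s :: "nat \<Rightarrow> nat"
    where s: "strict_mono s" "\<And>n. \<not> dist (X (s n)) L < \<epsilon>"
    by auto
  obtain r where "(\<lambda>j. X (s (r j))) \<longlonglongrightarrow> L"
    using assms[OF s(1)] by auto
  then show False
    using s(2) \<epsilon>(1) unfolding lim_sequentially by blast
qed

lemma weakly_convergesD:
  fixes f :: "'b::topological_space \<Rightarrow> real"
  assumes "weakly_converges \<mu> \<nu>" "continuous_on UNIV f" "\<And>x. \<bar>f x\<bar> \<le> B"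
  shows "(\<lambda>n. LINT x|\<mu> n. f x) \<longlonglongrightarrow> (LINT x|\<nu>. f x)"
proof -
  have "bounded (range f)"
    using assms(3) by (auto simp: bounded_iff)
  then show ?thesis
    using assms(1,2) unfolding weakly_converges_def by blast
qed

lemma weakly_converges_subseq:
  "weakly_converges \<mu> \<nu> \<Longrightarrow> strict_mono r \<Longrightarrow> weakly_converges (\<lambda>j. \<mu> (r j)) \<nu>"
  unfolding weakly_converges_def using LIMSEQ_subseq_LIMSEQ[of _ _ r] by (auto simp: comp_def)

lemma weakly_converges_const: "weakly_converges (\<lambda>_. \<mu>) \<mu>"
  by (simp add: weakly_converges_def)

lemma weakly_converges_if_subseqs:
  assumes "\<And>s :: nat \<Rightarrow> nat. strict_mono s \<Longrightarrow>
      \<exists>r. strict_mono r \<and> weakly_converges (\<lambda>j. \<mu> (s (r j))) \<nu>"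
  shows "weakly_converges \<mu> \<nu>"
  unfolding weakly_converges_def
proof (intro allI impI tendsto_if_subseqs)
  fix f :: "'a \<Rightarrow> real" and s :: "nat \<Rightarrow> nat"
  assume "continuous_on UNIV f \<and> bounded (range f)" "strict_mono s"
  then show "\<exists>r. strict_mono r \<and> (\<lambda>j. LINT x|\<mu> (s (r j)). f x) \<longlonglongrightarrow> (LINT x|\<nu>. f x)"
    using assms unfolding weakly_converges_def by blast
qed

lemma integrable_bounded_borel:
  fixes g :: "'b \<Rightarrow> 'c::{banach, second_countable_topology}"
  assumes "\<mu> \<in> space (prob_algebra A)" "g \<in> borel_measurable A" "\<And>x. norm (g x) \<le> B"
  shows "integrable \<mu> g"
proof -
  interpret prob_space \<mu> using assms(1) by (simp add: space_prob_algebra)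
  have "g \<in> borel_measurable \<mu>"
    using assms by (simp add: space_prob_algebra cong: measurable_cong_sets)
  then show ?thesis
    using assms(3) by (intro integrable_const_bound[of _ B]) auto
qed

lemma weakly_converges_complex:
  fixes g :: "'b::topological_space \<Rightarrow> complex"
  assumes "weakly_converges \<mu> \<nu>" "\<And>n. \<mu> n \<in> space (prob_algebra borel)" "\<nu> \<in> space (prob_algebra borel)"
    and g: "continuous_on UNIV g" "\<And>x. norm (g x) \<le> B"
  shows "(\<lambda>n. CLINT x|\<mu> n. g x) \<longlonglongrightarrow> (CLINT x|\<nu>. g x)"
proof -
  have int: "integrable \<kappa> g" if "\<kappa> \<in> space (prob_algebra borel)" for \<kappa>
    using integrable_bounded_borel[OF that] g borel_measurable_continuous_onI by blast
  have bnd: "\<bar>Re (g x)\<bar> \<le> B" "\<bar>Im (g x)\<bar> \<le> B" for x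
    using g(2)[of x] abs_Re_le_cmod[of "g x"] abs_Im_le_cmod[of "g x"] by linarith+
  have "(\<lambda>n. LINT x|\<mu> n. Re (g x)) \<longlonglongrightarrow> (LINT x|\<nu>. Re (g x))"
    "(\<lambda>n. LINT x|\<mu> n. Im (g x)) \<longlonglongrightarrow> (LINT x|\<nu>. Im (g x))"
    by (rule weakly_convergesD[OF assms(1) _ bnd(1)], intro continuous_intros g(1))
       (rule weakly_convergesD[OF assms(1) _ bnd(2)], intro continuous_intros g(1))
  then show ?thesis
    using int assms(2,3) by (simp add: tendsto_complex_iff)
qed

text \<open>
  If tightness failed, there would be members \<open>\<mu> (s k)\<close> with mass at least \<open>\<epsilon>\<close> outside the ball of
  radius \<open>k\<close>. A weak limit of a subsequence has mass less than \<open>\<epsilon>\<close> outside some ball, and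
  testing with a continuous cutoff of that ball gives a contradiction.
\<close>

lemma uniformly_tight_if_weakly_relatively_compact:
  fixes \<mu> :: "'i \<Rightarrow> 'b::real_normed_vector measure"
  assumes prob: "\<And>i. \<mu> i \<in> space (prob_algebra borel)"
    and cpt: "\<And>s :: nat \<Rightarrow> 'i. \<exists>r :: nat \<Rightarrow> nat. strict_mono r \<and>
      (\<exists>\<nu>\<in>space (prob_algebra borel). weakly_converges (\<lambda>j. \<mu> (s (r j))) \<nu>)"
  shows "uniformly_tight \<mu>"
  unfolding uniformly_tight_def
proof (rule ccontr)
  assume "\<not> (\<forall>\<epsilon>>0. \<exists>K. \<forall>i. measure (\<mu> i) {x. K < norm x} < \<epsilon>)"
  then obtain \<epsilon> where \<epsilon>: "\<epsilon> > 0" "\<And>K. \<exists>i. \<epsilon> \<le> measure (\<mu> i) {x. K < norm x}"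
    by (auto simp: not_less)
  then have "\<forall>k::nat. \<exists>i. \<epsilon> \<le> measure (\<mu> i) {x. real k < norm x}"
    by blast
  from choice[OF this] obtain s
    where s: "\<And>k::nat. \<epsilon> \<le> measure (\<mu> (s k)) {x. real k < norm x}"
    by auto
  obtain r \<nu> where r: "strict_mono r" "\<nu> \<in> space (prob_algebra borel)"
      "weakly_converges (\<lambda>j. \<mu> (s (r j))) \<nu>"
    using cpt[of s] by auto
  interpret \<nu>: prob_space \<nu> using r(2) by (simp add: in_prob_algebra_borel_iff)
  have sets_\<nu>: "sets \<nu> = sets borel" using r(2) by (simp add: in_prob_algebra_borel_iff)
  define cutoff :: "nat \<Rightarrow> 'b \<Rightarrow> real" where "cutoff k x = min 1 (max 0 (norm x - real k))" for k x
  have cont: "continuous_on UNIV (cutoff k)" for k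
    unfolding cutoff_def by (intro continuous_intros)
  have bnd: "\<bar>cutoff k x\<bar> \<le> 1" for k x
    by (auto simp: cutoff_def)
  have meas: "cutoff k \<in> borel_measurable borel" for k
    using cont by (rule borel_measurable_continuous_onI)
  have "(\<lambda>k. LINT x|\<nu>. cutoff k x) \<longlonglongrightarrow> (LINT x|\<nu>. 0)"
  proof (rule integral_dominated_convergence[where w="\<lambda>_. 1"])
    show "AE x in \<nu>. (\<lambda>k. cutoff k x) \<longlonglongrightarrow> 0"
    proof (rule AE_I2)
      fix x :: 'b
      have "eventually (\<lambda>k. cutoff k x = 0) sequentially"
        using eventually_ge_at_top[of "nat \<lceil>norm x\<rceil>"]
      proof eventually_elim
        case (elim k)
        then have "norm x \<le> real k" by linarith
        then show ?case by (simp add: cutoff_def)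
      qed
      then show "(\<lambda>k. cutoff k x) \<longlonglongrightarrow> 0"
        by (rule tendsto_eventually)
    qed
    show "cutoff k \<in> borel_measurable \<nu>" for k
      using meas by (simp add: measurable_cong_sets[OF sets_\<nu>])
  qed (use bnd in auto)
  then obtain k where k: "(LINT x|\<nu>. cutoff k x) < \<epsilon>"
    using \<epsilon>(1) order_tendstoD(2)[of "\<lambda>k. LINT x|\<nu>. cutoff k x" 0 sequentially \<epsilon>]
    by (auto simp: eventually_sequentially)
  have "(\<lambda>j. LINT x|\<mu> (s (r j)). cutoff k x) \<longlonglongrightarrow> (LINT x|\<nu>. cutoff k x)"
    using r(3) cont bnd by (rule weakly_convergesD)
  then have "eventually (\<lambda>j. (LINT x|\<mu> (s (r j)). cutoff k x) < \<epsilon>) sequentially"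
    using k by (rule order_tendstoD)
  with eventually_ge_at_top[of "Suc k"]
  have "eventually (\<lambda>j. False) sequentially"
  proof eventually_elim
    case (elim j)
    interpret p: prob_space "\<mu> (s (r j))" using prob by (simp add: in_prob_algebra_borel_iff)
    have sets_p: "sets (\<mu> (s (r j))) = sets borel" using prob by (simp add: in_prob_algebra_borel_iff)
    have "Suc k \<le> r j"
      using elim(1) strict_mono_imp_increasing[OF r(1), of j] by linarith
    then have le: "indicator {x. real (r j) < norm x} x \<le> cutoff k x" for x
      by (auto simp: cutoff_def indicator_def)
    have "\<epsilon> \<le> measure (\<mu> (s (r j))) {x. real (r j) < norm x}"
      by (rule s)
    also have "\<dots> = (LINT x|\<mu> (s (r j)). indicator {x. real (r j) < norm x} x)"
      using sets_p sets_eq_imp_space_eq[OF sets_p] by simp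
    also have "\<dots> \<le> (LINT x|\<mu> (s (r j)). cutoff k x)"
      using le meas bnd sets_p
      by (intro integral_mono integrable_bounded_borel[OF prob, where B=1]) auto
    finally show ?case
      using elim(2) by simp
  qed
  then show False by simp
qed

lemma uniformly_tight_if_weakly_converges:
  fixes \<mu> :: "nat \<Rightarrow> 'b::real_normed_vector measure"
  assumes prob: "\<And>n. \<mu> n \<in> space (prob_algebra borel)" "\<nu> \<in> space (prob_algebra borel)"
    and conv: "weakly_converges \<mu> \<nu>"
  shows "uniformly_tight \<mu>"
proof (rule uniformly_tight_if_weakly_relatively_compact[OF prob(1)])
  fix s :: "nat \<Rightarrow> nat"
  obtain r :: "nat \<Rightarrow> nat" where r: "strict_mono r" "(\<exists>k. \<forall>j. s (r j) = k) \<or> strict_mono (s \<circ> r)"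
    by (rule subseq_constant_or_strict_mono[of s]) (rule that; assumption)
  from r(2) have "\<exists>\<kappa>\<in>space (prob_algebra borel). weakly_converges (\<lambda>j. \<mu> (s (r j))) \<kappa>"
  proof
    assume "\<exists>k. \<forall>j. s (r j) = k"
    then obtain k where "\<And>j. s (r j) = k" by auto
    then show ?thesis
      using prob(1)[of k] weakly_converges_const[of "\<mu> k"] by auto
  next
    assume "strict_mono (s \<circ> r)"
    then show ?thesis
      using weakly_converges_subseq[OF conv, of "s \<circ> r"] prob(2) by auto
  qed
  with r(1) show "\<exists>r. strict_mono r \<and>
      (\<exists>\<kappa>\<in>space (prob_algebra borel). weakly_converges (\<lambda>j. \<mu> (s (r j))) \<kappa>)"
    by blast
qed

text \<open>
  The laws lifted to the line by the section \<open>\<psi>\<close> are tight because \<open>\<psi>\<close> is bounded on bounded sets.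
  A weak limit on the line, pushed forward by the continuous \<open>\<phi>\<close>, is a weak limit of the original
  laws because \<open>\<phi> \<circ> \<psi>\<close> is the identity.
\<close>

theorem Prokhorov_euclidean:
  fixes \<mu> :: "nat \<Rightarrow> 'b::euclidean_space measure"
  assumes prob: "\<And>n. \<mu> n \<in> space (prob_algebra borel)" and tight: "uniformly_tight \<mu>"
  obtains r \<nu> where "strict_mono r" "\<nu> \<in> space (prob_algebra borel)"
    "weakly_converges (\<lambda>j. \<mu> (r j)) \<nu>"
proof -
  obtain \<phi> :: "real \<Rightarrow> 'b" and \<psi>
    where \<phi>: "continuous_on UNIV \<phi>" "\<psi> \<in> borel_measurable borel" "\<And>x. \<phi> (\<psi> x) = x"
      "\<And>K. \<exists>L. \<forall>x. norm x \<le> K \<longrightarrow> \<bar>\<psi> x\<bar> \<le> L"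
    by (rule continuous_real_onto_euclidean_with_borel_section) (rule that; assumption)
  have sets_\<mu>[measurable_cong]: "sets (\<mu> n) = sets borel" and "prob_space (\<mu> n)" for n
    using prob by (auto simp: in_prob_algebra_borel_iff)
  note [measurable] = \<phi>(2) borel_measurable_continuous_onI[OF \<phi>(1)]
  define \<rho> where "\<rho> n = distr (\<mu> n) borel \<psi>" for n
  have real_\<rho>: "real_distribution (\<rho> n)" for n
  proof -
    interpret prob_space "\<mu> n" by fact
    show ?thesis unfolding \<rho>_def by (intro real_distribution_distr) measurable
  qed
  have "tight \<rho>"
    unfolding tight_def
  proof (intro conjI allI impI real_\<rho>)
    fix \<epsilon> :: real assume "\<epsilon> > 0"
    then obtain K where K: "\<And>n. measure (\<mu> n) {x. K < norm x} < \<epsilon>"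
      using tight unfolding uniformly_tight_def by blast
    obtain L where L: "\<And>x. norm x \<le> K \<Longrightarrow> \<bar>\<psi> x\<bar> \<le> L"
      using \<phi>(4) by blast
    define l where "l = \<bar>L\<bar> + 1"
    have "1 - \<epsilon> < measure (\<rho> n) {- l<..l}" for n
    proof -
      interpret prob_space "\<mu> n" by fact
      have sp: "space (\<mu> n) = UNIV" using sets_eq_imp_space_eq[OF sets_\<mu>] by simp
      have "1 - prob {x. K < norm x} = prob (UNIV - {x. K < norm x})"
        using prob_compl[of "{x. K < norm x}"] sp by (simp add: sets_\<mu>)
      also have "\<dots> \<le> prob (\<psi> -` {- l<..l} \<inter> space (\<mu> n))"
      proof (rule finite_measure_mono)
        show "UNIV - {x. K < norm x} \<subseteq> \<psi> -` {- l<..l} \<inter> space (\<mu> n)"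
          using L by (fastforce simp: sp l_def not_less abs_le_iff)
      qed measurable
      also have "\<dots> = measure (\<rho> n) {- l<..l}"
        unfolding \<rho>_def by (subst measure_distr) auto
      finally show ?thesis
        using K[of n] by linarith
    qed
    then show "\<exists>a b. a < b \<and> (\<forall>n. 1 - \<epsilon> < measure (\<rho> n) {a<..b})"
      by (intro exI[of _ "- l"] exI[of _ l]) (auto simp: l_def)
  qed
  from tight_imp_convergent_subsubsequence[OF this strict_mono_id]
  obtain r R where r: "strict_mono r" "real_distribution R" "weak_conv_m (\<lambda>j. \<rho> (r j)) R"
    by (auto simp: comp_def)
  interpret R: real_distribution R by fact
  show thesis
  proof (rule that[OF r(1)])
    have R_prob: "R \<in> space (prob_algebra borel)"
      using R.prob_space_axioms by (auto simp: in_prob_algebra_borel_iff)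
    then show "distr R borel \<phi> \<in> space (prob_algebra borel)"
      by (rule distr_in_prob_algebra) measurable
    show "weakly_converges (\<lambda>j. \<mu> (r j)) (distr R borel \<phi>)"
      unfolding weakly_converges_def
    proof (intro allI impI)
      fix f :: "'b \<Rightarrow> real" assume f: "continuous_on UNIV f \<and> bounded (range f)"
      then obtain B where B: "\<And>x. \<bar>f x\<bar> \<le> B"
        by (auto simp: bounded_iff)
      have [measurable]: "f \<in> borel_measurable borel"
        using f by (simp add: borel_measurable_continuous_onI)
      have "continuous_on UNIV (\<lambda>x. f (\<phi> x))"
        using f \<phi>(1) by (intro continuous_on_compose2[of UNIV f UNIV \<phi>]) auto
      then have "isCont (\<lambda>x. f (\<phi> x)) x" for x
        using continuous_on_eq_continuous_at[OF open_UNIV] by blast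
      then have "(\<lambda>j. LINT x|\<rho> (r j). f (\<phi> x)) \<longlonglongrightarrow> (LINT x|R. f (\<phi> x))"
        using B by (intro weak_conv_imp_integral_bdd_continuous_conv[where B=B] real_\<rho> r) auto
      moreover have "(LINT x|\<rho> n. f (\<phi> x)) = (LINT x|\<mu> n. f x)" for n
        unfolding \<rho>_def by (subst integral_distr) (auto simp: \<phi>(3))
      moreover have "(LINT x|distr R borel \<phi>. f x) = (LINT x|R. f (\<phi> x))"
        by (subst integral_distr) auto
      ultimately show "(\<lambda>j. LINT x|\<mu> (r j). f x) \<longlonglongrightarrow> (LINT x|distr R borel \<phi>. f x)"
        by simp
    qed
  qed
qed

section \<open>Characteristic functions on Euclidean spaces\<close>

lemma continuous_iexp_inner: "continuous_on UNIV (\<lambda>x. iexp (t \<bullet> x))" for t :: "'b::real_inner"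
  by (intro continuous_intros)

lemma iexp_inner_measurable[measurable]:
  "(\<lambda>x. iexp (t \<bullet> x)) \<in> borel_measurable borel" for t :: "'b::real_inner"
  by (rule borel_measurable_continuous_onI[OF continuous_iexp_inner])

lemma char_fun_distr:
  assumes "X \<in> borel_measurable M"
  shows "char_fun (distr M borel X) t = (CLINT \<omega>|M. iexp (t \<bullet> X \<omega>))"
  unfolding char_fun_def by (rule integral_distr[OF assms iexp_inner_measurable])

lemma norm_char_fun_le_1:
  assumes "\<mu> \<in> space (prob_algebra borel)"
  shows "norm (char_fun \<mu> t) \<le> 1"
proof -
  interpret prob_space \<mu> using assms by (simp add: in_prob_algebra_borel_iff)
  have "norm (char_fun \<mu> t) \<le> (LINT x|\<mu>. norm (iexp (t \<bullet> x)))"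
    unfolding char_fun_def by (rule integral_norm_bound)
  then show ?thesis by (simp add: prob_space)
qed

lemma continuous_char_fun:
  fixes \<mu> :: "'b::euclidean_space measure"
  assumes "\<mu> \<in> space (prob_algebra borel)"
  shows "continuous_on UNIV (char_fun \<mu>)"
proof -
  interpret prob_space \<mu> using assms by (simp add: in_prob_algebra_borel_iff)
  have sets_\<mu>[measurable_cong]: "sets \<mu> = sets borel"
    using assms by (simp add: in_prob_algebra_borel_iff)
  have "isCont (char_fun \<mu>) t" for t
    unfolding isCont_def char_fun_def
  proof (rule tendsto_at_iff_sequentially[THEN iffD2], intro allI impI, unfold comp_def)
    fix u :: "nat \<Rightarrow> 'b" assume "u \<longlonglongrightarrow> t"
    then show "(\<lambda>n. CLINT x|\<mu>. iexp (u n \<bullet> x)) \<longlonglongrightarrow> (CLINT x|\<mu>. iexp (t \<bullet> x))"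
      by (intro integral_dominated_convergence[where w="\<lambda>_. 1"])
         (auto intro!: tendsto_intros)
  qed
  then show ?thesis
    using continuous_on_eq_continuous_at[OF open_UNIV] by blast
qed

text \<open>
  If \<open>F\<close> has integral 0, both sides vanish. Otherwise the normalized weight \<open>F\<close> turns both measures
  into probability measures; the equation of the integrals says that the laws of \<open>G\<close> under them have the same characteristic function, so the
  uniqueness theorem on the line applies.
\<close>

lemma weighted_marginal_determined_by_char:
  fixes F :: "'b::topological_space \<Rightarrow> real" and G :: "'b \<Rightarrow> real"
  assumes prob: "\<mu> \<in> space (prob_algebra borel)" "\<nu> \<in> space (prob_algebra borel)"
    and F[measurable]: "F \<in> borel_measurable borel" and F_bounds: "\<And>x. 0 \<le> F x" "\<And>x. F x \<le> C"
    and G[measurable]: "G \<in> borel_measurable borel"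
    and eq: "\<And>s. (CLINT x|\<mu>. F x * iexp (s * G x)) = (CLINT x|\<nu>. F x * iexp (s * G x))"
    and A[measurable]: "A \<in> sets borel"
  shows "(LINT x|\<mu>. F x * indicator A (G x)) = (LINT x|\<nu>. F x * indicator A (G x))"
proof -
  have F_int: "integrable \<kappa> F" if "\<kappa> \<in> space (prob_algebra borel)" for \<kappa>
    using that F F_bounds by (intro integrable_bounded_borel[where B=C and A=borel]) auto
  define m where "m = (LINT x|\<mu>. F x)"
  have m_\<nu>: "m = (LINT x|\<nu>. F x)"
  proof -
    have "(CLINT x|\<mu>. complex_of_real (F x)) = (CLINT x|\<nu>. complex_of_real (F x))"
      using eq[of 0] by simp
    then show ?thesis
      unfolding m_def integral_complex_of_real of_real_eq_iff .
  qed
  show ?thesis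
  proof (cases "m = 0")
    case True
    have "(LINT x|\<kappa>. F x * indicator A (G x)) = 0"
      if \<kappa>: "\<kappa> \<in> space (prob_algebra borel)" "(LINT x|\<kappa>. F x) = 0" for \<kappa>
    proof -
      have "AE x in \<kappa>. F x = 0"
        using integral_nonneg_eq_0_iff_AE[OF F_int[OF \<kappa>(1)]] F_bounds(1) \<kappa>(2) by auto
      then have "AE x in \<kappa>. F x * indicator A (G x) = 0"
        by eventually_elim simp
      then show ?thesis by (rule integral_eq_zero_AE)
    qed
    then show ?thesis
      using prob True m_def m_\<nu> by simp
  next
    case False
    then have m: "m > 0"
      using F_bounds(1) by (simp add: m_def less_le)
    define law where "law \<kappa> = distr (density \<kappa> (\<lambda>x. ennreal (F x / m))) borel G" for \<kappa>
    have law: "real_distribution (law \<kappa>)"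
      "\<And>g :: real \<Rightarrow> 'z::{banach, second_countable_topology}. g \<in> borel_measurable borel \<Longrightarrow>
         integral\<^sup>L (law \<kappa>) g = (LINT x|\<kappa>. (F x / m) *\<^sub>R g (G x))"
      if \<kappa>: "\<kappa> \<in> space (prob_algebra borel)" "(LINT x|\<kappa>. F x) = m" for \<kappa>
    proof -
      have [measurable_cong]: "sets \<kappa> = sets borel"
        using \<kappa> by (simp add: in_prob_algebra_borel_iff)
      have "prob_space (density \<kappa> (\<lambda>x. ennreal (F x / m)))"
      proof (rule prob_spaceI)
        have "emeasure (density \<kappa> (\<lambda>x. ennreal (F x / m))) (space \<kappa>)
            = (\<integral>\<^sup>+ x. ennreal (F x / m) \<partial>\<kappa>)"
          by (subst emeasure_density) (auto intro!: nn_integral_cong)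
        also have "\<dots> = ennreal (LINT x|\<kappa>. F x / m)"
          using F_int[OF \<kappa>(1)] F_bounds(1) m by (intro nn_integral_eq_integral) auto
        finally show "emeasure (density \<kappa> (\<lambda>x. ennreal (F x / m)))
            (space (density \<kappa> (\<lambda>x. ennreal (F x / m)))) = 1"
          using \<kappa>(2) m by simp
      qed
      then interpret d: prob_space "density \<kappa> (\<lambda>x. ennreal (F x / m))" .
      show "real_distribution (law \<kappa>)"
        unfolding law_def by (intro d.real_distribution_distr) measurable
      show "integral\<^sup>L (law \<kappa>) g = (LINT x|\<kappa>. (F x / m) *\<^sub>R g (G x))"
        if [measurable]: "g \<in> borel_measurable borel" for g :: "real \<Rightarrow> 'z"
        unfolding law_def using F_bounds(1) m
        by (subst integral_distr, measurable, subst integral_density) auto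
    qed
    note law_\<mu> = law[OF prob(1) m_def[symmetric]] and law_\<nu> = law[OF prob(2) m_\<nu>[symmetric]]
    have "char (law \<mu>) s = char (law \<nu>) s" for s
    proof -
      have "(CLINT x|\<kappa>. (F x / m) *\<^sub>R iexp (s * G x)) = (CLINT x|\<kappa>. F x * iexp (s * G x)) / m" for \<kappa>
      proof -
        have "(F x / m) *\<^sub>R iexp (s * G x) = F x * iexp (s * G x) / m" for x
          by (simp add: scaleR_conv_of_real)
        then show ?thesis
          by (simp only: integral_divide_zero)
      qed
      then show ?thesis
        unfolding char_def using eq[of s] by (simp add: law_\<mu>(2) law_\<nu>(2))
    qed
    then have "law \<mu> = law \<nu>"
      by (intro Levy_uniqueness law_\<mu> law_\<nu>) auto
    then have "(LINT y|law \<mu>. indicator A y :: real) = (LINT y|law \<nu>. indicator A y)"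
      by (rule arg_cong)
    then have "(LINT x|\<mu>. F x * indicator A (G x) / m) = (LINT x|\<nu>. F x * indicator A (G x) / m)"
      by (subst (asm) law_\<mu>(2), simp, subst (asm) law_\<nu>(2), simp) simp
    then show ?thesis
      using m by simp
  qed
qed

text \<open>
  Localizing to Borel sets in one further coordinate \<open>j\<close>. To apply the uniqueness theorem on the line
  to that coordinate, the oscillating factor \<open>iexp (t \<bullet> x)\<close> has to become a nonnegative weight: the
  weights \<open>1 + cos (t \<bullet> x + \<theta>)\<close> are nonnegative, their characteristic functions in direction \<open>j\<close>
  are combinations of values known by induction, and the phases \<open>\<theta> = 0\<close> and \<open>\<theta> = - pi / 2\<close> recover
  the real and the imaginary part.
\<close>

lemma char_fun_determines_localized_char_fun:
  fixes \<mu> \<nu> :: "'b::euclidean_space measure"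
  assumes prob: "\<mu> \<in> space (prob_algebra borel)" "\<nu> \<in> space (prob_algebra borel)"
    and eq: "\<And>t. char_fun \<mu> t = char_fun \<nu> t"
    and "finite A" and B: "\<And>i. B i \<in> sets borel"
  shows "(CLINT x|\<mu>. of_real (\<Prod>i\<in>A. indicator (B i) (x \<bullet> i)) * iexp (t \<bullet> x))
       = (CLINT x|\<nu>. of_real (\<Prod>i\<in>A. indicator (B i) (x \<bullet> i)) * iexp (t \<bullet> x))"
  using \<open>finite A\<close>
proof (induction A arbitrary: t)
  case empty
  then show ?case
    using eq[of t] by (simp add: char_fun_def)
next
  case (insert j A)
  note [measurable] = B
  define F :: "'b \<Rightarrow> real" where "F x = (\<Prod>i\<in>A. indicator (B i) (x \<bullet> i))" for x
  have F_meas[measurable]: "F \<in> borel_measurable borel"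
    unfolding F_def by measurable
  have F01: "0 \<le> F x" "F x \<le> 1" for x
    unfolding F_def by (auto intro!: prod_nonneg prod_le_1 simp: indicator_def)
  have IH: "(CLINT x|\<mu>. F x * iexp (s \<bullet> x)) = (CLINT x|\<nu>. F x * iexp (s \<bullet> x))" for s
    using insert.IH[of s] by (simp add: F_def)
  have int: "integrable \<kappa> (\<lambda>x. complex_of_real (F x) * iexp (s \<bullet> x))"
    if "\<kappa> \<in> space (prob_algebra borel)" for \<kappa> s
    by (rule integrable_bounded_borel[OF that, where B=1]) (use F01 in \<open>auto simp: norm_mult\<close>)
  have wave: "(LINT x|\<mu>. F x * (1 + cos (s \<bullet> x + \<theta>)) * indicator (B j) (x \<bullet> j))
            = (LINT x|\<nu>. F x * (1 + cos (s \<bullet> x + \<theta>)) * indicator (B j) (x \<bullet> j))" for s \<theta>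
  proof (rule weighted_marginal_determined_by_char[OF prob, where C=2])
    show "F x * (1 + cos (s \<bullet> x + \<theta>)) \<le> 2" for x
      using mult_mono[of "F x" 1 "1 + cos (s \<bullet> x + \<theta>)" 2] F01[of x]
        cos_le_one[of "s \<bullet> x + \<theta>"] cos_ge_minus_one[of "s \<bullet> x + \<theta>"] by simp
    show "0 \<le> F x * (1 + cos (s \<bullet> x + \<theta>))" for x
      using F01[of x] cos_ge_minus_one[of "s \<bullet> x + \<theta>"]
      by (intro mult_nonneg_nonneg) linarith+
    fix r :: real
    have expand: "complex_of_real (F x * (1 + cos (s \<bullet> x + \<theta>))) * iexp (r * (x \<bullet> j))
       = F x * iexp ((r *\<^sub>R j) \<bullet> x) + (iexp \<theta> / 2) * (F x * iexp ((s + r *\<^sub>R j) \<bullet> x))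
         + (iexp (- \<theta>) / 2) * (F x * iexp ((- s + r *\<^sub>R j) \<bullet> x))" for x
    proof -
      have "complex_of_real (cos a) = (iexp a + iexp (- a)) / 2" for a
        by (simp add: cos_exp_eq cos_of_real[symmetric] del: cos_of_real)
      then show ?thesis
        by (simp add: inner_add_left exp_add[symmetric] algebra_simps inner_commute[of j x] add_divide_distrib)
    qed
    show "(CLINT x|\<mu>. complex_of_real (F x * (1 + cos (s \<bullet> x + \<theta>))) * iexp (r * (x \<bullet> j)))
        = (CLINT x|\<nu>. complex_of_real (F x * (1 + cos (s \<bullet> x + \<theta>))) * iexp (r * (x \<bullet> j)))"
    proof -
      have "(CLINT x|\<kappa>. complex_of_real (F x * (1 + cos (s \<bullet> x + \<theta>))) * iexp (r * (x \<bullet> j)))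
          = (CLINT x|\<kappa>. F x * iexp ((r *\<^sub>R j) \<bullet> x))
            + (iexp \<theta> / 2) * (CLINT x|\<kappa>. F x * iexp ((s + r *\<^sub>R j) \<bullet> x))
            + (iexp (- \<theta>) / 2) * (CLINT x|\<kappa>. F x * iexp ((- s + r *\<^sub>R j) \<bullet> x))"
        if "\<kappa> \<in> space (prob_algebra borel)" for \<kappa>
        unfolding expand
        by (simp only: int[OF that] Bochner_Integration.integral_add
              Bochner_Integration.integrable_add integrable_mult_right integral_mult_right_zero)
      then show ?thesis
        using prob by (simp only: IH)
    qed
  qed measurable
  define I where "I x = F x * indicator (B j) (x \<bullet> j)" for x
  have I_meas[measurable]: "I \<in> borel_measurable borel"
    unfolding I_def by measurable
  have I01: "0 \<le> I x" "I x \<le> 1" for x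
    unfolding I_def using F01[of x] by (auto simp: indicator_def)
  have int_I: "integrable \<kappa> (\<lambda>x. I x * g x)"
    if "\<kappa> \<in> space (prob_algebra borel)" "g \<in> borel_measurable borel" "\<And>x. \<bar>g x\<bar> \<le> 1" for \<kappa> and g :: "'b \<Rightarrow> real"
    using that I01
    by (intro integrable_bounded_borel[OF that(1), where B=1]) (auto simp: abs_mult intro!: mult_le_one)
  \<comment> \<open>At \<open>s = 0\<close> this phase makes the cosine vanish and leaves the weight 1.\<close>
  have plain: "(LINT x|\<mu>. I x) = (LINT x|\<nu>. I x)"
    using wave[of 0 "- pi / 2"] by (simp add: I_def)
  have I_cos: "(LINT x|\<mu>. I x * cos (t \<bullet> x + \<theta>)) = (LINT x|\<nu>. I x * cos (t \<bullet> x + \<theta>))" for \<theta>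
  proof -
    have "F x * (1 + cos (t \<bullet> x + \<theta>)) * indicator (B j) (x \<bullet> j) = I x * 1 + I x * cos (t \<bullet> x + \<theta>)" for x
      by (simp add: I_def algebra_simps)
    then have "(LINT x|\<kappa>. F x * (1 + cos (t \<bullet> x + \<theta>)) * indicator (B j) (x \<bullet> j))
       = (LINT x|\<kappa>. I x) + (LINT x|\<kappa>. I x * cos (t \<bullet> x + \<theta>))"
      if "\<kappa> \<in> space (prob_algebra borel)" for \<kappa>
      using int_I[OF that, of "\<lambda>_. 1"] int_I[OF that, of "\<lambda>x. cos (t \<bullet> x + \<theta>)"] by simp
    then show ?thesis
      using wave[of t \<theta>] plain prob by simp
  qed
  have "(CLINT x|\<kappa>. complex_of_real (I x) * iexp (t \<bullet> x))
      = of_real (LINT x|\<kappa>. I x * cos (t \<bullet> x + 0)) + \<i> * of_real (LINT x|\<kappa>. I x * cos (t \<bullet> x + (- pi / 2)))"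
    if "\<kappa> \<in> space (prob_algebra borel)" for \<kappa>
  proof -
    have int_I_iexp: "integrable \<kappa> (\<lambda>x. complex_of_real (I x) * iexp (t \<bullet> x))"
      by (rule integrable_bounded_borel[OF that, where B=1]) (use I01 in \<open>auto simp: norm_mult\<close>)
    have "Re (CLINT x|\<kappa>. complex_of_real (I x) * iexp (t \<bullet> x)) = (LINT x|\<kappa>. I x * cos (t \<bullet> x + 0))"
      by (subst integral_Re[OF int_I_iexp, symmetric]) (simp add: Re_exp)
    moreover have "Im (CLINT x|\<kappa>. complex_of_real (I x) * iexp (t \<bullet> x))
        = (LINT x|\<kappa>. I x * cos (t \<bullet> x + (- pi / 2)))"
      by (subst integral_Im[OF int_I_iexp, symmetric]) (simp add: Im_exp cos_diff)
    ultimately show ?thesis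
      by (simp add: complex_eq_iff)
  qed
  then have "(CLINT x|\<mu>. complex_of_real (I x) * iexp (t \<bullet> x)) = (CLINT x|\<nu>. complex_of_real (I x) * iexp (t \<bullet> x))"
    using prob by (simp only: I_cos)
  then show ?case
    using insert.hyps by (simp add: I_def F_def mult.commute mult.left_commute mult.assoc)
qed

text \<open>
  Boxes generate the Borel sets and are intersections of constraints on single coordinates, so the
  localized characteristic functions at \<open>t = 0\<close> are their measures.
\<close>

theorem char_fun_unique:
  fixes \<mu> \<nu> :: "'b::euclidean_space measure"
  assumes prob: "\<mu> \<in> space (prob_algebra borel)" "\<nu> \<in> space (prob_algebra borel)"
    and eq: "\<And>t. char_fun \<mu> t = char_fun \<nu> t"
  shows "\<mu> = \<nu>"
proof (rule measure_eqI_generator_eq[where E="range (\<lambda>(a, b). box a b)" and \<Omega>=UNIV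
      and A="\<lambda>n. box (- (real n *\<^sub>R One)) (real n *\<^sub>R One)"])
  have sets_borel_box: "sets (borel :: 'b measure) = sigma_sets UNIV (range (\<lambda>(a, b). box a b))"
    by (subst borel_eq_box) (rule sets_measure_of, simp)
  have meas_box: "complex_of_real (measure \<kappa> (box a b))
      = (CLINT x|\<kappa>. of_real (\<Prod>i\<in>Basis. indicator {a \<bullet> i<..<b \<bullet> i} (x \<bullet> i)) * iexp (0 \<bullet> x))"
    if "\<kappa> \<in> space (prob_algebra borel)" for \<kappa> :: "'b measure" and a b
  proof -
    have "(\<Prod>i\<in>Basis. indicator {a \<bullet> i<..<b \<bullet> i} (x \<bullet> i)) = (indicator (box a b) x :: real)" for x
      by (auto simp: indicator_def box_def prod_eq_1_iff of_bool_def intro!: prod_zero)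
    moreover have "space \<kappa> = UNIV"
      using that sets_eq_imp_space_eq[of \<kappa> borel] by (simp add: in_prob_algebra_borel_iff)
    ultimately show ?thesis
      by simp
  qed
  show "emeasure \<mu> X = emeasure \<nu> X" if X: "X \<in> range (\<lambda>(a, b). box a b)" for X
  proof -
    obtain a b where X_eq: "X = box a b" using X by auto
    have "measure \<mu> X = measure \<nu> X"
      unfolding X_eq of_real_eq_iff[where 'a=complex, symmetric] meas_box[OF prob(1)] meas_box[OF prob(2)]
      by (rule char_fun_determines_localized_char_fun[OF prob eq]) auto
    then show ?thesis
      using prob by (simp add: in_prob_algebra_borel_iff prob_space.finite_measure
          finite_measure.emeasure_eq_measure)
  qed
  show "emeasure \<mu> (box (- (real n *\<^sub>R One)) (real n *\<^sub>R One)) \<noteq> \<infinity>" for n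
    using prob by (simp add: in_prob_algebra_borel_iff prob_space.finite_measure
          finite_measure.emeasure_eq_measure)
  show "sets \<mu> = sigma_sets UNIV (range (\<lambda>(a, b). box a b))"
    "sets \<nu> = sigma_sets UNIV (range (\<lambda>(a, b). box a b))"
    using prob sets_borel_box by (simp_all add: in_prob_algebra_borel_iff)
qed (auto simp: Int_stable_def box_Int_box UN_box_eq_UNIV)

text \<open>
  The coordinates converge weakly by the continuity theorem on the line, hence are tight, and so the
  vectors are tight. Every subsequence then has a weakly convergent subsequence, and its limit is
  \<open>\<nu>\<close> because its characteristic function is that of \<open>\<nu>\<close>.
\<close>

theorem levy_continuity_euclidean:
  fixes \<mu> :: "nat \<Rightarrow> 'b::euclidean_space measure"
  assumes prob: "\<And>n. \<mu> n \<in> space (prob_algebra borel)" "\<nu> \<in> space (prob_algebra borel)"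
    and char: "\<And>t. (\<lambda>n. char_fun (\<mu> n) t) \<longlonglongrightarrow> char_fun \<nu> t"
  shows "uniformly_tight \<mu>" "weakly_converges \<mu> \<nu>"
proof -
  have [measurable]: "(\<lambda>x. x \<bullet> b) \<in> borel_measurable borel" for b :: 'b
    by (intro borel_measurable_continuous_onI continuous_intros)
  have coord_tight: "uniformly_tight (\<lambda>n. distr (\<mu> n) borel (\<lambda>x. x \<bullet> b))" for b
  proof -
    define coord where "coord \<kappa> = distr \<kappa> borel (\<lambda>x. x \<bullet> b)" for \<kappa>
    have coord_prob: "coord \<kappa> \<in> space (prob_algebra borel)" if "\<kappa> \<in> space (prob_algebra borel)" for \<kappa>
      unfolding coord_def using that by (rule distr_in_prob_algebra) measurable
    have coord_real: "real_distribution (coord \<kappa>)" if "\<kappa> \<in> space (prob_algebra borel)" for \<kappa>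
      using coord_prob[OF that]
      by (auto simp: in_prob_algebra_borel_iff real_distribution_def real_distribution_axioms_def)
    have coord_char: "char (coord \<kappa>) s = char_fun \<kappa> (s *\<^sub>R b)" if "\<kappa> \<in> space (prob_algebra borel)" for \<kappa> s
    proof -
      have "sets \<kappa> = sets borel" using that by (simp add: in_prob_algebra_borel_iff)
      then show ?thesis
        unfolding char_def coord_def char_fun_def
        by (subst integral_distr) (auto simp: inner_commute cong: measurable_cong_sets)
    qed
    have "weak_conv_m (\<lambda>n. coord (\<mu> n)) (coord \<nu>)"
      by (rule levy_continuity) (auto simp: coord_real coord_char prob char)
    then have "weakly_converges (\<lambda>n. coord (\<mu> n)) (coord \<nu>)"
      unfolding weakly_converges_def
    proof (intro allI impI)
      fix f :: "real \<Rightarrow> real" assume f: "continuous_on UNIV f \<and> bounded (range f)"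
      then obtain C where C: "\<And>x. \<bar>f x\<bar> \<le> C" by (auto simp: bounded_iff)
      have "isCont f x" for x
        using f continuous_on_eq_continuous_at[OF open_UNIV] by blast
      then show "(\<lambda>n. LINT x|coord (\<mu> n). f x) \<longlonglongrightarrow> (LINT x|coord \<nu>. f x)"
        using C \<open>weak_conv_m (\<lambda>n. coord (\<mu> n)) (coord \<nu>)\<close>
        by (intro weak_conv_imp_integral_bdd_continuous_conv[where B=C] coord_real prob) auto
    qed
    then show ?thesis
      unfolding coord_def[symmetric]
      by (rule uniformly_tight_if_weakly_converges[OF coord_prob[OF prob(1)] coord_prob[OF prob(2)]])
  qed
  show tight: "uniformly_tight \<mu>"
    unfolding uniformly_tight_def
  proof (intro allI impI)
    fix \<epsilon> :: real assume "\<epsilon> > 0"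
    then have "\<forall>b. \<exists>K. \<forall>n. measure (distr (\<mu> n) borel (\<lambda>x. x \<bullet> b)) {y. K < norm y} < \<epsilon> / DIM('b)"
      using coord_tight unfolding uniformly_tight_def by simp
    from choice[OF this] obtain K
      where K: "\<And>b n. measure (distr (\<mu> n) borel (\<lambda>x. x \<bullet> b)) {y. K b < norm y} < \<epsilon> / DIM('b)"
      by auto
    show "\<exists>L. \<forall>n. measure (\<mu> n) {x. L < norm x} < \<epsilon>"
    proof (intro exI[of _ "\<Sum>b\<in>Basis. K b"] allI)
      fix n
      interpret prob_space "\<mu> n" using prob by (simp add: in_prob_algebra_borel_iff)
      have sets_\<mu>[measurable_cong]: "sets (\<mu> n) = sets borel"
        using prob by (simp add: in_prob_algebra_borel_iff)
      have sp: "space (\<mu> n) = UNIV" using sets_eq_imp_space_eq[OF sets_\<mu>] by simp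
      have "prob {x. (\<Sum>b\<in>Basis. K b) < norm x} \<le> prob (\<Union>b\<in>Basis. {x. K b < \<bar>x \<bullet> b\<bar>})"
      proof (rule finite_measure_mono)
        show "{x. (\<Sum>b\<in>Basis. K b) < norm x} \<subseteq> (\<Union>b\<in>Basis. {x. K b < \<bar>x \<bullet> b\<bar>})"
        proof (rule ccontr, clarsimp simp: subset_eq not_less)
          fix x assume "(\<Sum>b\<in>Basis. K b) < norm x" "\<forall>b\<in>Basis. \<bar>x \<bullet> b\<bar> \<le> K b"
          then show False
            using norm_le_l1[of x] sum_mono[of Basis "\<lambda>b. \<bar>x \<bullet> b\<bar>" K] by auto
        qed
        show "(\<Union>b\<in>Basis. {x. K b < \<bar>x \<bullet> b\<bar>}) \<in> events"
          unfolding sets_\<mu> by (intro sets.finite_UN) measurable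
      qed
      also have "\<dots> \<le> (\<Sum>b\<in>Basis. prob {x. K b < \<bar>x \<bullet> b\<bar>})"
        by (rule finite_measure_subadditive_finite) (auto simp: sets_\<mu>)
      also have "\<dots> = (\<Sum>b\<in>Basis. measure (distr (\<mu> n) borel (\<lambda>x. x \<bullet> b)) {y. K b < norm y})"
        by (intro sum.cong refl, subst measure_distr) (auto simp: sp vimage_def)
      also have "\<dots> < (\<Sum>b\<in>(Basis::'b set). \<epsilon> / DIM('b))"
        using K by (intro sum_strict_mono) auto
      also have "\<dots> = \<epsilon>" by simp
      finally show "prob {x. (\<Sum>b\<in>Basis. K b) < norm x} < \<epsilon>" .
    qed
  qed
  show "weakly_converges \<mu> \<nu>"
  proof (rule weakly_converges_if_subseqs)
    fix s :: "nat \<Rightarrow> nat" assume s: "strict_mono s"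
    have "uniformly_tight (\<lambda>j. \<mu> (s j))"
      using tight unfolding uniformly_tight_def by blast
    then obtain r \<kappa> where r: "strict_mono r" and \<kappa>: "\<kappa> \<in> space (prob_algebra borel)"
      and conv: "weakly_converges (\<lambda>j. \<mu> (s (r j))) \<kappa>"
      using Prokhorov_euclidean[of "\<lambda>j. \<mu> (s j)"] prob(1) by blast
    have "char_fun \<kappa> t = char_fun \<nu> t" for t
    proof (rule LIMSEQ_unique)
      show "(\<lambda>j. char_fun (\<mu> (s (r j))) t) \<longlonglongrightarrow> char_fun \<kappa> t"
        unfolding char_fun_def
        by (rule weakly_converges_complex[OF conv prob(1) \<kappa> continuous_iexp_inner, where B=1]) simp
      show "(\<lambda>j. char_fun (\<mu> (s (r j))) t) \<longlonglongrightarrow> char_fun \<nu> t"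
        using LIMSEQ_subseq_LIMSEQ[OF char strict_mono_o[OF s r]] by (simp add: comp_def)
    qed
    then have "\<kappa> = \<nu>"
      by (intro char_fun_unique \<kappa> prob(2))
    then show "\<exists>r. strict_mono r \<and> weakly_converges (\<lambda>j. \<mu> (s (r j))) \<nu>"
      using r conv by auto
  qed
qed

section \<open>Independent random indices and coherency\<close>

text \<open>
  With \<open>h\<close> the characteristic function of \<open>Y\<close>, this is the characteristic function of \<open>u Y + v\<close> as a
  function of the scale and shift \<open>w = (u, v)\<close>.
\<close>

definition mixture_kernel :: "('b::real_inner \<Rightarrow> complex) \<Rightarrow> 'b \<Rightarrow> real \<times> 'b \<Rightarrow> complex" where
  "mixture_kernel h t w = h (fst w *\<^sub>R t) * iexp (t \<bullet> snd w)"

lemma norm_mixture_kernel: "norm (mixture_kernel h t w) = norm (h (fst w *\<^sub>R t))"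
  by (simp add: mixture_kernel_def norm_mult)

lemma continuous_mixture_kernel:
  assumes "continuous_on UNIV h"
  shows "continuous_on UNIV (mixture_kernel h t)"
  unfolding mixture_kernel_def
  by (intro continuous_intros continuous_on_compose2[OF assms]) auto

lemma integral_eq_if_eq_on_index_fibres:
  fixes f g :: "'a \<Rightarrow> 'c::{banach, second_countable_topology}" and N :: "'a \<Rightarrow> nat"
  assumes [measurable]: "N \<in> measurable M (count_space UNIV)"
    and int: "integrable M f" "integrable M g"
    and eq: "\<And>k. (LINT \<omega>:{\<omega>\<in>space M. N \<omega> = k}|M. f \<omega>) = (LINT \<omega>:{\<omega>\<in>space M. N \<omega> = k}|M. g \<omega>)"
  shows "(LINT \<omega>|M. f \<omega>) = (LINT \<omega>|M. g \<omega>)"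
proof -
  have whole: "(\<Union>k. {\<omega>\<in>space M. N \<omega> = k}) = space M" by auto
  have split: "(LINT \<omega>|M. u \<omega>) = (\<Sum>k. LINT \<omega>:{\<omega>\<in>space M. N \<omega> = k}|M. u \<omega>)"
    if "integrable M u" for u :: "'a \<Rightarrow> 'c"
  proof -
    have "set_integrable M (\<Union>k. {\<omega>\<in>space M. N \<omega> = k}) u"
      using that unfolding whole set_integrable_def by (simp add: integrable_mult_indicator)
    then have "(LINT \<omega>:(\<Union>k. {\<omega>\<in>space M. N \<omega> = k})|M. u \<omega>)
        = (\<Sum>k. LINT \<omega>:{\<omega>\<in>space M. N \<omega> = k}|M. u \<omega>)"
      by (rule lebesgue_integral_countable_add[rotated 2]) auto
    then show ?thesis
      unfolding whole using set_integral_space[OF that] by simp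
  qed
  show ?thesis
    unfolding split[OF int(1)] split[OF int(2)] eq ..
qed

text \<open>
  Independence of the index and \<open>X\<close> enters only through the indicator \<open>J\<close> of the event \<open>N = k\<close> and
  the function \<open>g (X)\<close>, which take values in the same type, so the product rule for independent
  variables applies to them.
\<close>

lemma (in prob_space) set_integral_independent:
  fixes g :: "'b::topological_space \<Rightarrow> complex"
  assumes indep: "independent_rvs M (count_space UNIV) N borel X"
    and meas[measurable]: "N \<in> measurable M (count_space UNIV)" "X \<in> borel_measurable M"
      "g \<in> borel_measurable borel"
    and bound: "\<And>x. norm (g x) \<le> B"
  shows "(CLINT \<omega>:{\<omega>\<in>space M. N \<omega> = k}|M. g (X \<omega>))
       = (CLINT \<omega>:{\<omega>\<in>space M. N \<omega> = k}|M. (CLINT \<omega>'|M. g (X \<omega>')))"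
proof -
  define J :: "'a \<Rightarrow> complex" where "J \<omega> = (if N \<omega> = k then 1 else 0)" for \<omega>
  have J_meas[measurable]: "J \<in> borel_measurable M"
    unfolding J_def by measurable
  have "indep_set (sigma_sets (space M) {J -` A \<inter> space M | A. A \<in> sets borel})
      (sigma_sets (space M) {(\<lambda>\<omega>. g (X \<omega>)) -` A \<inter> space M | A. A \<in> sets borel})"
    using indep unfolding independent_rvs_def indep_set_def
  proof (rule indep_sets_mono_sets)
    have J_sub: "sigma_sets (space M) {J -` A \<inter> space M | A. A \<in> sets borel}
        \<subseteq> sets (vimage_algebra (space M) N (count_space UNIV))"
    proof -
      have "J -` A \<inter> space M = N -` {n. (if n = k then 1 else 0) \<in> A} \<inter> space M" for A
        by (auto simp: J_def)
      moreover have "N -` B \<inter> space M \<in> sets (vimage_algebra (space M) N (count_space UNIV))" for B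
        by (rule in_vimage_algebra) simp
      ultimately have "{J -` A \<inter> space M | A. A \<in> sets borel}
          \<subseteq> sets (vimage_algebra (space M) N (count_space UNIV))"
        by (simp only: Collect_mono_iff) blast
      from sets.sigma_sets_subset[OF this] show ?thesis by simp
    qed
    have g_sub: "sigma_sets (space M) {(\<lambda>\<omega>. g (X \<omega>)) -` A \<inter> space M | A. A \<in> sets borel}
        \<subseteq> sets (vimage_algebra (space M) X borel)"
    proof -
      have "(\<lambda>\<omega>. g (X \<omega>)) -` A \<inter> space M = X -` (g -` A) \<inter> space M" for A
        by auto
      moreover have "g -` A \<in> sets borel" if "A \<in> sets borel" for A
        using measurable_sets[OF meas(3) that] by simp
      ultimately have "{(\<lambda>\<omega>. g (X \<omega>)) -` A \<inter> space M | A. A \<in> sets borel}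
          \<subseteq> sets (vimage_algebra (space M) X borel)"
        by (auto intro!: in_vimage_algebra)
      from sets.sigma_sets_subset[OF this] show ?thesis by simp
    qed
    show "case_bool (sigma_sets (space M) {J -` A \<inter> space M | A. A \<in> sets borel})
        (sigma_sets (space M) {(\<lambda>\<omega>. g (X \<omega>)) -` A \<inter> space M | A. A \<in> sets borel}) i
        \<subseteq> case_bool (sets (vimage_algebra (space M) N (count_space UNIV)))
           (sets (vimage_algebra (space M) X borel)) i" for i
      using J_sub g_sub by (cases i) auto
  qed
  then have "indep_var borel J borel (\<lambda>\<omega>. g (X \<omega>))"
    unfolding indep_var_eq by simp
  moreover have "integrable M J" "integrable M (\<lambda>\<omega>. g (X \<omega>))"
    by (rule integrable_const_bound[of _ 1], simp_all add: J_def)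
       (rule integrable_const_bound[of _ B], simp_all add: bound)
  ultimately have "(CLINT \<omega>|M. J \<omega> * g (X \<omega>)) = (CLINT \<omega>|M. J \<omega>) * (CLINT \<omega>|M. g (X \<omega>))"
    by (rule indep_var_lebesgue_integral)
  moreover have "(CLINT \<omega>:{\<omega>\<in>space M. N \<omega> = k}|M. u \<omega>) = (CLINT \<omega>|M. J \<omega> * u \<omega>)" for u :: "'a \<Rightarrow> complex"
    unfolding set_lebesgue_integral_def by (intro Bochner_Integration.integral_cong) (auto simp: J_def)
  ultimately show ?thesis
    by simp
qed

text \<open>
  Fubini's theorem for a discrete index. On the event \<open>N = k\<close> only \<open>X k\<close>
  occurs, so it suffices that the index is independent of each single \<open>X k\<close>.
\<close>

lemma (in prob_space) integral_independent_random_index: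
  fixes g :: "nat \<Rightarrow> 'b::topological_space \<Rightarrow> complex"
  assumes indep: "\<And>k. independent_rvs M (count_space UNIV) N borel (X k)"
    and meas[measurable]: "N \<in> measurable M (count_space UNIV)" "\<And>k. X k \<in> borel_measurable M"
      "\<And>k. g k \<in> borel_measurable borel"
    and bound: "\<And>k x. norm (g k x) \<le> B"
  shows "(CLINT \<omega>|M. g (N \<omega>) (X (N \<omega>) \<omega>)) = (CLINT \<omega>|M. (CLINT \<omega>'|M. g (N \<omega>) (X (N \<omega>) \<omega>')))"
proof (rule integral_eq_if_eq_on_index_fibres[OF meas(1)])
  have "norm (CLINT \<omega>'|M. g k (X k \<omega>')) \<le> B" for k
  proof -
    have int: "integrable M (\<lambda>\<omega>'. g k (X k \<omega>'))"
      by (rule integrable_const_bound[of _ B]) (simp_all add: bound)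
    have "norm (CLINT \<omega>'|M. g k (X k \<omega>')) \<le> (LINT \<omega>'|M. norm (g k (X k \<omega>')))"
      by (rule integral_norm_bound)
    also have "\<dots> \<le> (LINT \<omega>'|M. B)"
      using int bound by (intro integral_mono) auto
    finally show ?thesis by (simp add: prob_space)
  qed
  then show "integrable M (\<lambda>\<omega>. CLINT \<omega>'|M. g (N \<omega>) (X (N \<omega>) \<omega>'))"
    by (intro integrable_const_bound[of _ B]
        measurable_compose[OF meas(1), of "\<lambda>k. CLINT \<omega>'|M. g k (X k \<omega>')"]) auto
  have "(\<lambda>\<omega>. g (N \<omega>) (X (N \<omega>) \<omega>)) \<in> borel_measurable M"
    by (rule measurable_compose_countable[where f="\<lambda>k \<omega>. g k (X k \<omega>)"]) measurable
  then show "integrable M (\<lambda>\<omega>. g (N \<omega>) (X (N \<omega>) \<omega>))"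
    using bound by (intro integrable_const_bound[of _ B]) auto
  fix k
  have "(CLINT \<omega>:{\<omega>\<in>space M. N \<omega> = k}|M. g (N \<omega>) (X (N \<omega>) \<omega>))
      = (CLINT \<omega>:{\<omega>\<in>space M. N \<omega> = k}|M. g k (X k \<omega>))"
    by (rule set_lebesgue_integral_cong) auto
  also have "\<dots> = (CLINT \<omega>:{\<omega>\<in>space M. N \<omega> = k}|M. (CLINT \<omega>'|M. g k (X k \<omega>')))"
    by (rule set_integral_independent[OF indep meas(1,2,3) bound])
  also have "\<dots> = (CLINT \<omega>:{\<omega>\<in>space M. N \<omega> = k}|M. (CLINT \<omega>'|M. g (N \<omega>) (X (N \<omega>) \<omega>')))"
    by (rule set_lebesgue_integral_cong) auto
  finally show "(CLINT \<omega>:{\<omega>\<in>space M. N \<omega> = k}|M. g (N \<omega>) (X (N \<omega>) \<omega>))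
      = (CLINT \<omega>:{\<omega>\<in>space M. N \<omega> = k}|M. (CLINT \<omega>'|M. g (N \<omega>) (X (N \<omega>) \<omega>')))" .
qed

text \<open>
  Where the scale is at most \<open>K\<close>, the argument of \<open>H\<close> and \<open>h\<close> lies in the ball of radius
  \<open>K * norm t\<close>, and the difference is controlled by the supremum in the coherency condition; elsewhere
  it is at most 2, on an event of small probability.
\<close>

lemma (in prob_space) mixture_kernel_coherent_limit:
  fixes H :: "nat \<Rightarrow> nat \<Rightarrow> 'b::euclidean_space \<Rightarrow> complex" and h :: "'b \<Rightarrow> complex"
    and W :: "nat \<Rightarrow> nat \<Rightarrow> real \<times> 'b"
  assumes N[measurable]: "\<And>n. N n \<in> measurable M (count_space UNIV)"
    and H: "\<And>n k t. norm (H n k t) \<le> 1" and h: "\<And>t. norm (h t) \<le> 1"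
    and coherency: "\<And>T::real. T > 0 \<Longrightarrow>
      (\<lambda>n. LINT \<omega>|M. (SUP t\<in>cball 0 T. norm (H n (N n \<omega>) t - h t))) \<longlonglongrightarrow> 0"
    and tight: "\<And>\<epsilon>. \<epsilon> > 0 \<Longrightarrow> \<exists>K. \<forall>n. prob {\<omega>\<in>space M. K < \<bar>fst (W n (N n \<omega>))\<bar>} < \<epsilon>"
  shows "(\<lambda>n. (CLINT \<omega>|M. mixture_kernel (H n (N n \<omega>)) t (W n (N n \<omega>)))
            - (CLINT \<omega>|M. mixture_kernel h t (W n (N n \<omega>)))) \<longlonglongrightarrow> 0"
proof (rule LIMSEQ_I)
  fix \<epsilon> :: real assume \<epsilon>: "\<epsilon> > 0"
  then obtain K where K: "\<And>n. prob {\<omega>\<in>space M. K < \<bar>fst (W n (N n \<omega>))\<bar>} < \<epsilon> / 4"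
    using tight[of "\<epsilon> / 4"] by auto
  \<comment> \<open>The summand 1 only serves to make the radius positive.\<close>
  define T where "T = \<bar>K\<bar> * norm t + 1"
  have T: "T > 0" by (simp add: T_def add_nonneg_pos)
  define gap where "gap n k = (SUP t\<in>cball 0 T. norm (H n k t - h t))" for n k
  have diff: "norm (H n k s - h s) \<le> 2" for n k s
    using norm_triangle_ineq4[of "H n k s" "h s"] H[of n k s] h[of s] by linarith
  have bdd: "bdd_above ((\<lambda>s. norm (H n k s - h s)) ` cball 0 T)" for n k
    using diff by (auto intro!: bdd_aboveI2[where M=2])
  have gap_ge: "norm (H n k s - h s) \<le> gap n k" if "norm s \<le> T" for n k s
    unfolding gap_def using that by (intro cSUP_upper bdd) auto
  have gap_bounds: "0 \<le> gap n k" "gap n k \<le> 2" for n k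
  proof -
    show "0 \<le> gap n k"
      using gap_ge[of 0 n k] T order_trans[OF norm_ge_zero] by auto
    show "gap n k \<le> 2"
      unfolding gap_def using diff T by (intro cSUP_least) auto
  qed
  have gap_meas[measurable]: "(\<lambda>\<omega>. gap n (N n \<omega>)) \<in> borel_measurable M" for n
    by (rule measurable_compose[OF N]) simp
  have gap_int: "integrable M (\<lambda>\<omega>. gap n (N n \<omega>))" for n
    using gap_bounds by (intro integrable_const_bound[of _ 2]) auto
  obtain n0 where n0: "\<And>n. n \<ge> n0 \<Longrightarrow> (LINT \<omega>|M. gap n (N n \<omega>)) < \<epsilon> / 2"
    using order_tendstoD(2)[OF coherency[OF T], of "\<epsilon> / 2"] \<epsilon>
    unfolding gap_def eventually_sequentially by auto
  show "\<exists>n0. \<forall>n\<ge>n0. norm ((CLINT \<omega>|M. mixture_kernel (H n (N n \<omega>)) t (W n (N n \<omega>)))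
            - (CLINT \<omega>|M. mixture_kernel h t (W n (N n \<omega>))) - 0) < \<epsilon>"
  proof (intro exI[of _ n0] allI impI)
    fix n assume n: "n \<ge> n0"
    define bad where "bad = {\<omega>\<in>space M. K < \<bar>fst (W n (N n \<omega>))\<bar>}"
    have [measurable]: "(\<lambda>\<omega>. fst (W n (N n \<omega>))) \<in> borel_measurable M"
      by (rule measurable_compose[OF N]) simp
    have bad_meas[measurable]: "bad \<in> events"
      unfolding bad_def by measurable
    have bad_int: "integrable M (\<lambda>\<omega>. 2 * indicator bad \<omega> :: real)"
      by (rule integrable_const_bound[of _ 2]) (auto simp: indicator_def)
    have int: "integrable M (\<lambda>\<omega>. mixture_kernel (f (N n \<omega>)) t (W n (N n \<omega>)))"
      if "\<And>k s. norm (f k s) \<le> 1" for f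
      using that by (intro integrable_const_bound[of _ 1] measurable_compose[OF N,
          of "\<lambda>k. mixture_kernel (f k) t (W n k)"]) (auto simp: norm_mixture_kernel)
    have pointwise: "norm (mixture_kernel (H n (N n \<omega>)) t (W n (N n \<omega>)) - mixture_kernel h t (W n (N n \<omega>)))
        \<le> gap n (N n \<omega>) + 2 * indicator bad \<omega>" if \<omega>: "\<omega> \<in> space M" for \<omega>
    proof -
      define s where "s = fst (W n (N n \<omega>)) *\<^sub>R t"
      have "mixture_kernel (H n (N n \<omega>)) t (W n (N n \<omega>)) - mixture_kernel h t (W n (N n \<omega>))
          = (H n (N n \<omega>) s - h s) * iexp (t \<bullet> snd (W n (N n \<omega>)))"
        by (simp add: mixture_kernel_def s_def algebra_simps)
      then have "norm (mixture_kernel (H n (N n \<omega>)) t (W n (N n \<omega>)) - mixture_kernel h t (W n (N n \<omega>)))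
          = norm (H n (N n \<omega>) s - h s)"
        by (simp add: norm_mult)
      also have "\<dots> \<le> gap n (N n \<omega>) + 2 * indicator bad \<omega>"
      proof (cases "\<omega> \<in> bad")
        case True
        then show ?thesis
          using diff[of n "N n \<omega>" s] gap_bounds(1)[of n "N n \<omega>"] by simp
      next
        case False
        then have "\<bar>fst (W n (N n \<omega>))\<bar> \<le> \<bar>K\<bar>"
          using \<omega> by (auto simp: bad_def)
        then have "norm s \<le> T"
          using mult_right_mono[of "\<bar>fst (W n (N n \<omega>))\<bar>" "\<bar>K\<bar>" "norm t"] by (simp add: s_def T_def)
        then show ?thesis
          using gap_ge[of s n "N n \<omega>"] False by simp
      qed
      finally show ?thesis .
    qed
    have "norm ((CLINT \<omega>|M. mixture_kernel (H n (N n \<omega>)) t (W n (N n \<omega>)))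
            - (CLINT \<omega>|M. mixture_kernel h t (W n (N n \<omega>))))
        = norm (CLINT \<omega>|M. mixture_kernel (H n (N n \<omega>)) t (W n (N n \<omega>)) - mixture_kernel h t (W n (N n \<omega>)))"
      using int[of "H n"] int[of "\<lambda>_. h"] H h by simp
    also have "\<dots> \<le> (LINT \<omega>|M. norm (mixture_kernel (H n (N n \<omega>)) t (W n (N n \<omega>)) - mixture_kernel h t (W n (N n \<omega>))))"
      by (rule integral_norm_bound)
    also have "\<dots> \<le> (LINT \<omega>|M. gap n (N n \<omega>) + 2 * indicator bad \<omega>)"
      using int[of "H n"] int[of "\<lambda>_. h"] H h gap_int bad_int pointwise
      by (intro integral_mono) auto
    also have "\<dots> = (LINT \<omega>|M. gap n (N n \<omega>)) + 2 * prob bad"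
      by (subst Bochner_Integration.integral_add[OF gap_int bad_int]) simp
    also have "\<dots> < \<epsilon>"
      using n0[OF n] K[of n] unfolding bad_def by linarith
    finally show "norm ((CLINT \<omega>|M. mixture_kernel (H n (N n \<omega>)) t (W n (N n \<omega>)))
            - (CLINT \<omega>|M. mixture_kernel h t (W n (N n \<omega>))) - 0) < \<epsilon>" by simp
  qed
qed

section \<open>Limits of the laws of mixing vectors\<close>

lemma sets_pair_borel:
  assumes "sets A = sets (borel :: 'a::second_countable_topology measure)"
    and "sets B = sets (borel :: 'b::second_countable_topology measure)"
  shows "sets (A \<Otimes>\<^sub>M B) = sets borel"
  unfolding sets_pair_measure_cong[OF assms] borel_prod ..

lemma char_fun_affine_mixture:
  fixes \<kappa> :: "(real \<times> 'b::euclidean_space) measure" and \<eta> :: "'b measure"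
  assumes prob: "\<kappa> \<in> space (prob_algebra borel)" "\<eta> \<in> space (prob_algebra borel)"
  shows "char_fun (distr (\<kappa> \<Otimes>\<^sub>M \<eta>) borel (\<lambda>(w, y). fst w *\<^sub>R y + snd w)) t
       = (CLINT w|\<kappa>. mixture_kernel (char_fun \<eta>) t w)"
proof -
  interpret \<kappa>: prob_space \<kappa> using prob by (simp add: in_prob_algebra_borel_iff)
  interpret \<eta>: prob_space \<eta> using prob by (simp add: in_prob_algebra_borel_iff)
  interpret pair_prob_space \<kappa> \<eta> ..
  have sets_pair: "sets (\<kappa> \<Otimes>\<^sub>M \<eta>) = sets borel"
    using prob by (intro sets_pair_borel) (auto simp: in_prob_algebra_borel_iff)
  have "(\<lambda>(w, y). fst w *\<^sub>R y + snd w) \<in> borel_measurable (borel :: ((real \<times> 'b) \<times> 'b) measure)"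
    by (intro borel_measurable_continuous_onI) (auto simp: case_prod_beta' intro!: continuous_intros)
  then have meas[measurable]: "(\<lambda>(w, y). fst w *\<^sub>R y + snd w) \<in> borel_measurable (\<kappa> \<Otimes>\<^sub>M \<eta>)"
    by (simp add: measurable_cong_sets[OF sets_pair])
  have meas_iexp: "(\<lambda>p. iexp (t \<bullet> (case p of (w, y) \<Rightarrow> fst w *\<^sub>R y + snd w))) \<in> borel_measurable (\<kappa> \<Otimes>\<^sub>M \<eta>)"
    by (rule measurable_compose[OF meas iexp_inner_measurable])
  have int: "integrable (\<kappa> \<Otimes>\<^sub>M \<eta>) (\<lambda>p. iexp (t \<bullet> (case p of (w, y) \<Rightarrow> fst w *\<^sub>R y + snd w)))"
    using meas_iexp by (intro P.integrable_const_bound[of _ 1]) auto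
  have "(CLINT p|\<kappa> \<Otimes>\<^sub>M \<eta>. iexp (t \<bullet> (case p of (w, y) \<Rightarrow> fst w *\<^sub>R y + snd w)))
      = (CLINT w|\<kappa>. CLINT y|\<eta>. iexp (t \<bullet> (fst w *\<^sub>R y + snd w)))"
    using integral_fst'[OF int] by simp
  also have "\<dots> = (CLINT w|\<kappa>. mixture_kernel (char_fun \<eta>) t w)"
  proof (rule Bochner_Integration.integral_cong)
    fix w :: "real \<times> 'b"
    have "iexp (t \<bullet> (fst w *\<^sub>R y + snd w)) = iexp ((fst w *\<^sub>R t) \<bullet> y) * iexp (t \<bullet> snd w)" for y
      by (simp add: inner_add_right algebra_simps flip: exp_add)
    then show "(CLINT y|\<eta>. iexp (t \<bullet> (fst w *\<^sub>R y + snd w))) = mixture_kernel (char_fun \<eta>) t w"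
      unfolding mixture_kernel_def char_fun_def by simp
  qed simp
  finally show ?thesis
    by (simp add: char_fun_distr[OF meas])
qed

text \<open>
  By the preceding lemma and Levy's continuity theorem, the laws \<open>\<rho> n\<close> of \<open>u Y + v\<close> are tight, where
  \<open>Y\<close> has law \<open>\<eta>\<close> and is independent of \<open>(u, v)\<close>. If \<open>u\<close> is bounded by \<open>k\<close> and \<open>v\<close> is large,
  then \<open>u Y + v\<close> is large with probability at least 1/2, namely if \<open>Y\<close> is in a ball \<open>B\<close> of mass at
  least 1/2. So a large \<open>v\<close> is at most twice as likely as a large \<open>u Y + v\<close>.
\<close>

lemma uniformly_tight_mixing_laws:
  fixes \<kappa> :: "nat \<Rightarrow> (real \<times> 'b::euclidean_space) measure" and \<eta> \<zeta> :: "'b measure"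
  assumes prob: "\<And>n. \<kappa> n \<in> space (prob_algebra borel)" "\<eta> \<in> space (prob_algebra borel)"
      "\<zeta> \<in> space (prob_algebra borel)"
    and tight_scale: "\<And>\<epsilon>. \<epsilon> > 0 \<Longrightarrow> \<exists>K. \<forall>n. measure (\<kappa> n) {w. K < \<bar>fst w\<bar>} < \<epsilon>"
    and conv: "\<And>t. (\<lambda>n. CLINT w|\<kappa> n. mixture_kernel (char_fun \<eta>) t w) \<longlonglongrightarrow> char_fun \<zeta> t"
  shows "uniformly_tight \<kappa>"
proof -
  let ?mix = "\<lambda>(w :: real \<times> 'b, y :: 'b). fst w *\<^sub>R y + snd w"
  define \<rho> where "\<rho> n = distr (\<kappa> n \<Otimes>\<^sub>M \<eta>) borel ?mix" for n
  have sets_\<kappa>[measurable_cong]: "sets (\<kappa> n) = sets borel" and prob_\<kappa>: "prob_space (\<kappa> n)" for n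
    using prob by (auto simp: in_prob_algebra_borel_iff)
  have sets_\<eta>[measurable_cong]: "sets \<eta> = sets borel" and prob_\<eta>: "prob_space \<eta>"
    using prob by (auto simp: in_prob_algebra_borel_iff)
  have space_UNIV: "space (\<kappa> n) = UNIV" "space \<eta> = UNIV" for n
    using sets_eq_imp_space_eq[OF sets_\<kappa>] sets_eq_imp_space_eq[OF sets_\<eta>] by auto
  have sets_pair: "sets (\<kappa> n \<Otimes>\<^sub>M \<eta>) = sets borel" for n
    by (intro sets_pair_borel sets_\<kappa> sets_\<eta>)
  have "?mix \<in> borel_measurable borel"
    by (intro borel_measurable_continuous_onI) (auto simp: case_prod_beta' intro!: continuous_intros)
  then have meas[measurable]: "?mix \<in> borel_measurable (\<kappa> n \<Otimes>\<^sub>M \<eta>)" for n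
    by (simp add: measurable_cong_sets[OF sets_pair])
  have [measurable]: "(fst :: real \<times> 'b \<Rightarrow> real) \<in> borel_measurable borel"
    "(snd :: real \<times> 'b \<Rightarrow> 'b) \<in> borel_measurable borel"
    by (intro borel_measurable_continuous_onI continuous_intros)+
  have prob_pair: "prob_space (\<kappa> n \<Otimes>\<^sub>M \<eta>)" for n
    by (intro prob_space_pair prob_\<kappa> prob_\<eta>)
  have prob_\<rho>: "\<rho> n \<in> space (prob_algebra borel)" for n
    unfolding \<rho>_def in_prob_algebra_borel_iff
    using prob_space.prob_space_distr[OF prob_pair meas] by simp
  have tight_\<rho>: "uniformly_tight \<rho>"
    by (rule levy_continuity_euclidean(1)[OF prob_\<rho> prob(3)])
       (use conv in \<open>simp add: \<rho>_def char_fun_affine_mixture[OF prob(1,2)]\<close>)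
  have tight_\<eta>: "uniformly_tight (\<lambda>_::nat. \<eta>)"
    by (rule uniformly_tight_if_weakly_converges[OF prob(2) prob(2) weakly_converges_const])
  show ?thesis
    unfolding uniformly_tight_def
  proof (intro allI impI)
    fix \<epsilon> :: real assume \<epsilon>: "\<epsilon> > 0"
    obtain k where k: "\<And>n. measure (\<kappa> n) {w. k < \<bar>fst w\<bar>} < \<epsilon> / 2"
      using tight_scale[of "\<epsilon> / 2"] \<epsilon> by auto
    obtain l where l: "\<And>n. measure (\<rho> n) {x. l < norm x} < \<epsilon> / 4"
      using tight_\<rho> \<epsilon> unfolding uniformly_tight_def by (meson divide_pos_pos zero_less_numeral)
    obtain K' where K': "measure \<eta> {y. K' < norm y} < 1 / 2"
      using tight_\<eta> unfolding uniformly_tight_def by (meson divide_pos_pos zero_less_numeral zero_less_one)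
    define R where "R = \<bar>k\<bar> * \<bar>K'\<bar> + l"
    show "\<exists>L. \<forall>n. measure (\<kappa> n) {w. L < norm w} < \<epsilon>"
    proof (intro exI[of _ "k + R"] allI)
      fix n
      interpret \<kappa>: prob_space "\<kappa> n" by (rule prob_\<kappa>)
      interpret \<eta>: prob_space \<eta> by (rule prob_\<eta>)
      interpret pair: prob_space "\<kappa> n \<Otimes>\<^sub>M \<eta>" by (rule prob_pair)
      define A where "A = {w :: real \<times> 'b. \<bar>fst w\<bar> \<le> k \<and> R < norm (snd w)}"
      define B where "B = {y :: 'b. norm y \<le> K'}"
      have A[measurable]: "A \<in> sets (\<kappa> n)" and k_set: "{w. k < \<bar>fst w\<bar>} \<in> sets (\<kappa> n)"
        unfolding A_def sets_\<kappa> by measurable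
      have B[measurable]: "B \<in> sets \<eta>"
        unfolding B_def sets_\<eta> by measurable
      have "{y :: 'b. K' < norm y} \<in> sets \<eta>"
        unfolding sets_\<eta> by measurable
      moreover have "B = space \<eta> - {y. K' < norm y}"
        by (auto simp: B_def space_UNIV)
      ultimately have "1 / 2 \<le> measure \<eta> B"
        using K' \<eta>.prob_compl[of "{y. K' < norm y}"] by simp
      then have "measure (\<kappa> n) A / 2 \<le> measure (\<kappa> n) A * measure \<eta> B"
        using mult_left_mono[of "1 / 2" "measure \<eta> B" "measure (\<kappa> n) A"] by simp
      also have "\<dots> = measure (\<kappa> n \<Otimes>\<^sub>M \<eta>) (A \<times> B)"
        using \<eta>.emeasure_pair_measure_Times[OF A B] by (simp add: measure_def enn2real_mult)
      also have "\<dots> \<le> measure (\<kappa> n \<Otimes>\<^sub>M \<eta>) (?mix -` {x. l < norm x} \<inter> space (\<kappa> n \<Otimes>\<^sub>M \<eta>))"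
      proof (rule pair.finite_measure_mono)
        show "A \<times> B \<subseteq> ?mix -` {x. l < norm x} \<inter> space (\<kappa> n \<Otimes>\<^sub>M \<eta>)"
        proof (clarsimp simp: A_def B_def space_pair_measure space_UNIV)
          fix u :: real and v y :: 'b
          assume *: "\<bar>u\<bar> \<le> k" "R < norm v" "norm y \<le> K'"
          have "norm v \<le> norm (u *\<^sub>R y + v) + norm (u *\<^sub>R y)"
            using norm_triangle_ineq4[of "u *\<^sub>R y + v" "u *\<^sub>R y"] by simp
          moreover have "norm (u *\<^sub>R y) \<le> \<bar>k\<bar> * \<bar>K'\<bar>"
            using * by (auto intro!: mult_mono)
          ultimately show "l < norm (u *\<^sub>R y + v)"
            using * by (simp add: R_def)
        qed
      qed measurable
      also have "\<dots> = measure (\<rho> n) {x. l < norm x}"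
        unfolding \<rho>_def by (subst measure_distr) auto
      also have "\<dots> < \<epsilon> / 4"
        by (rule l)
      finally have "measure (\<kappa> n) A < \<epsilon> / 2"
        by simp
      moreover have "measure (\<kappa> n) {w. k + R < norm w} \<le> measure (\<kappa> n) ({w. k < \<bar>fst w\<bar>} \<union> A)"
      proof (rule \<kappa>.finite_measure_mono)
        show "{w. k + R < norm w} \<subseteq> {w. k < \<bar>fst w\<bar>} \<union> A"
        proof
          fix w :: "real \<times> 'b" assume "w \<in> {w. k + R < norm w}"
          then show "w \<in> {w. k < \<bar>fst w\<bar>} \<union> A"
            using norm_Pair_le[of "fst w" "snd w"] by (auto simp: A_def)
        qed
      qed (use k_set A in auto)
      moreover have "\<dots> \<le> measure (\<kappa> n) {w. k < \<bar>fst w\<bar>} + measure (\<kappa> n) A"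
        by (rule measure_Un_le[OF k_set A])
      ultimately show "measure (\<kappa> n) {w. k + R < norm w} < \<epsilon>"
        using k[of n] by linarith
    qed
  qed
qed

text \<open>
  The bounded continuous function \<open>min 1 (max 0 (- fst w))\<close> is positive exactly where the first component is negative, so its
  integrals vanish along the sequence and hence in the limit.
\<close>

lemma weak_limit_nonneg:
  fixes \<kappa> :: "nat \<Rightarrow> (real \<times> 'b::real_normed_vector) measure"
  assumes prob: "\<And>n. \<kappa> n \<in> space (prob_algebra borel)" "\<mu> \<in> space (prob_algebra borel)"
    and conv: "weakly_converges \<kappa> \<mu>"
    and nonneg: "\<And>n. AE w in \<kappa> n. 0 \<le> fst w"
  shows "AE w in \<mu>. 0 \<le> fst w"
proof -
  define f :: "real \<times> 'b \<Rightarrow> real" where "f w = min 1 (max 0 (- fst w))" for w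
  have cont: "continuous_on UNIV f"
    unfolding f_def by (intro continuous_intros)
  have bnd: "\<bar>f w\<bar> \<le> 1" for w
    by (auto simp: f_def)
  have "(\<lambda>n. LINT w|\<kappa> n. f w) \<longlonglongrightarrow> (LINT w|\<mu>. f w)"
    using conv cont bnd by (rule weakly_convergesD)
  moreover have "(LINT w|\<kappa> n. f w) = 0" for n
    by (rule integral_eq_zero_AE) (use nonneg[of n] in \<open>auto simp: f_def\<close>)
  ultimately have "(LINT w|\<mu>. f w) = 0"
    using LIMSEQ_unique[OF tendsto_const, of 0] by auto
  moreover have "integrable \<mu> f"
    by (rule integrable_bounded_borel[OF prob(2) borel_measurable_continuous_onI[OF cont], where B=1])
       (use bnd in simp)
  ultimately have "AE w in \<mu>. f w = 0"
    by (subst (asm) integral_nonneg_eq_0_iff_AE) (auto simp: f_def)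
  then show ?thesis
    by eventually_elim (auto simp: f_def min_def max_def split: if_splits)
qed

section \<open>Convergence of randomly indexed sums\<close>

theorem theorem2:
  fixes M :: "'a measure"
    and S :: "nat \<Rightarrow> nat \<Rightarrow> 'a \<Rightarrow> real ^ 'm"
    and a :: "nat \<Rightarrow> nat \<Rightarrow> real ^ 'm"
    and b :: "nat \<Rightarrow> nat \<Rightarrow> real"
    and N :: "nat \<Rightarrow> 'a \<Rightarrow> nat"
    and c :: "nat \<Rightarrow> real ^ 'm"
    and d :: "nat \<Rightarrow> real"
    and Y Z :: "'a \<Rightarrow> real ^ 'm"
    and \<Lambda> :: "(real \<times> (real ^ 'm)) measure \<Rightarrow> (real \<times> (real ^ 'm)) measure \<Rightarrow> real"
    and h_arr :: "nat \<Rightarrow> nat \<Rightarrow> real ^ 'm \<Rightarrow> complex"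
    and h :: "real ^ 'm \<Rightarrow> complex"
    and Z_seq V_seq :: "nat \<Rightarrow> 'a \<Rightarrow> real ^ 'm"
    and U_seq :: "nat \<Rightarrow> 'a \<Rightarrow> real"
    and W_seq :: "nat \<Rightarrow> 'a \<Rightarrow> real \<times> (real ^ 'm)"
  defines "h_arr \<equiv> \<lambda>n k. char_fun (distr M borel (\<lambda>\<omega>. inverse (b n k) *\<^sub>R (S n k \<omega> - a n k)))"
    and "h \<equiv> char_fun (distr M borel Y)"
    and "Z_seq \<equiv> \<lambda>n \<omega>. inverse (d n) *\<^sub>R (S n (N n \<omega>) \<omega> - c n)"
    and "U_seq \<equiv> \<lambda>n \<omega>. inverse (d n) * b n (N n \<omega>)"
    and "V_seq \<equiv> \<lambda>n \<omega>. inverse (d n) *\<^sub>R (a n (N n \<omega>) - c n)"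
    and "W_seq \<equiv> \<lambda>n \<omega>. (U_seq n \<omega>, V_seq n \<omega>)"
  assumes "prob_space M"
    and "rich_for M TYPE(real \<times> (real ^ 'm))"
    and "\<And>n k. S n k \<in> borel_measurable M"
    and "\<And>n k. b n k > 0"
    and "\<And>n. N n \<in> measurable M (count_space UNIV)"
    and "\<And>n k. independent_rvs M (count_space UNIV) (N n) borel (S n k)"
    and "\<And>n. d n > 0"
    and "Y \<in> borel_measurable M"
    and "metrizes_weak_convergence \<Lambda>"
    and "weakly_relatively_compact M U_seq"
    and coherency: "\<And>T::real. T > 0 \<Longrightarrow>
      (\<lambda>n. LINT \<omega>|M. (SUP t\<in>cball 0 T. norm (h_arr n (N n \<omega>) t - h t))) \<longlonglongrightarrow> 0"
    and "Z \<in> borel_measurable M"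
  shows "converges_in_distribution M Z_seq Z \<longleftrightarrow>
    (\<exists>W_star :: nat \<Rightarrow> 'a \<Rightarrow> real \<times> (real ^ 'm).
       (\<forall>n. W_star n \<in> mixing_vectors M Z Y) \<and>
       weakly_relatively_compact M W_star \<and>
       (\<lambda>n. \<Lambda> (distr M borel (W_star n)) (distr M borel (W_seq n))) \<longlonglongrightarrow> 0)"
proof -
  interpret prob_space M by fact
  note N_meas[measurable] = assms(11) and Z_meas[measurable] = assms(18)
  have S_meas[measurable]: "S n k \<in> borel_measurable M" for n k by fact
  define w where "w n k = (inverse (d n) * b n k, inverse (d n) *\<^sub>R (a n k - c n))" for n k
  have W_eq: "W_seq n = (\<lambda>\<omega>. w n (N n \<omega>))" for n
    by (simp add: W_seq_def U_seq_def V_seq_def w_def)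
  have W_meas[measurable]: "W_seq n \<in> borel_measurable M" for n
    unfolding W_eq by (rule measurable_compose[OF N_meas]) simp
  have scale_meas: "(\<lambda>\<omega>. fst (w n (N n \<omega>))) \<in> borel_measurable M" for n
    by (rule measurable_compose[OF N_meas]) simp
  have U_eq: "U_seq n = (\<lambda>\<omega>. fst (W_seq n \<omega>))" for n
    by (simp add: W_seq_def)
  have U_meas[measurable]: "U_seq n \<in> borel_measurable M" for n
    unfolding U_seq_def by (rule measurable_compose[OF N_meas]) simp
  have Z_seq_meas[measurable]: "Z_seq n \<in> borel_measurable M" for n
    unfolding Z_seq_def
    by (rule measurable_compose_countable[where f="\<lambda>k \<omega>. inverse (d n) *\<^sub>R (S n k \<omega> - c n)"]) measurable
  have distr_prob: "distr M borel X \<in> space (prob_algebra borel)" if "X \<in> borel_measurable M" for X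
    using that prob_space_distr by (simp add: in_prob_algebra_borel_iff)
  define \<kappa> where "\<kappa> n = distr M borel (W_seq n)" for n
  have \<kappa>_prob: "\<kappa> n \<in> space (prob_algebra borel)" for n
    unfolding \<kappa>_def by (rule distr_prob) measurable
  have Y_prob: "distr M borel Y \<in> space (prob_algebra borel)" and Z_prob: "distr M borel Z \<in> space (prob_algebra borel)"
    using assms(14,18) by (auto intro: distr_prob)
  have h_cont: "continuous_on UNIV h" and h_bound: "norm (h t) \<le> 1" for t
    unfolding h_def using Y_prob by (auto intro: continuous_char_fun norm_char_fun_le_1)
  have kernel_cont: "continuous_on UNIV (mixture_kernel h t)" for t
    by (rule continuous_mixture_kernel[OF h_cont])
  have kernel_bound: "norm (mixture_kernel h t v) \<le> 1" for t v
    by (simp add: norm_mixture_kernel h_bound)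
  have kernel_distr: "(CLINT v|distr M borel X. mixture_kernel h t v) = (CLINT \<omega>|M. mixture_kernel h t (X \<omega>))"
    if "X \<in> borel_measurable M" for X t
    by (rule integral_distr[OF that borel_measurable_continuous_onI[OF kernel_cont]])
  have kernel_limit: "(\<lambda>j. CLINT v|\<mu> j. mixture_kernel h t v) \<longlonglongrightarrow> (CLINT v|\<nu>. mixture_kernel h t v)"
    if "weakly_converges \<mu> \<nu>" "\<And>j. \<mu> j \<in> space (prob_algebra borel)" "\<nu> \<in> space (prob_algebra borel)" for \<mu> \<nu> t
    by (rule weakly_converges_complex[OF that kernel_cont kernel_bound])
  have mixing_iff: "X \<in> mixing_vectors M Z Y \<longleftrightarrow>
      (AE v in distr M borel X. 0 \<le> fst v) \<and>
      (\<forall>t. (CLINT v|distr M borel X. mixture_kernel h t v) = char_fun (distr M borel Z) t)"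
    if X[measurable]: "X \<in> borel_measurable M" for X
  proof -
    have [measurable]: "(fst :: real \<times> (real ^ 'm) \<Rightarrow> real) \<in> borel_measurable borel"
      by (intro borel_measurable_continuous_onI continuous_intros)
    have "prob {\<omega> \<in> space M. 0 \<le> fst (X \<omega>)} = 1 \<longleftrightarrow> (AE \<omega> in M. 0 \<le> fst (X \<omega>))"
      by (rule prob_Collect_eq_1) measurable
    also have "\<dots> \<longleftrightarrow> (AE v in distr M borel X. 0 \<le> fst v)"
      by (rule AE_distr_iff[symmetric]) measurable
    finally show ?thesis
      unfolding mixing_vectors_def kernel_distr[OF X] using X
      by (auto simp: mixture_kernel_def h_def)
  qed

  have char_Z_seq: "char_fun (distr M borel (Z_seq n)) t
      = (CLINT \<omega>|M. mixture_kernel (h_arr n (N n \<omega>)) t (w n (N n \<omega>)))" for n t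
  proof -
    define g where "g k x = iexp (t \<bullet> (inverse (d n) *\<^sub>R (x - c n)))" for k :: nat and x
    have "char_fun (distr M borel (Z_seq n)) t = (CLINT \<omega>|M. g (N n \<omega>) (S n (N n \<omega>) \<omega>))"
      by (subst char_fun_distr) (simp_all add: g_def Z_seq_def Z_seq_meas[unfolded Z_seq_def])
    also have "\<dots> = (CLINT \<omega>|M. CLINT \<omega>'|M. g (N n \<omega>) (S n (N n \<omega>) \<omega>'))"
    proof (rule integral_independent_random_index[where g=g and B=1])
      show "g k \<in> borel_measurable borel" for k
        unfolding g_def by measurable
    qed (use assms(12) in \<open>auto simp: g_def\<close>)
    also have "\<dots> = (CLINT \<omega>|M. mixture_kernel (h_arr n (N n \<omega>)) t (w n (N n \<omega>)))"
    proof -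
      have "(CLINT \<omega>'|M. g k (S n k \<omega>')) = mixture_kernel (h_arr n k) t (w n k)" for k
      proof -
        have "inverse (d n) *\<^sub>R (x - c n)
            = fst (w n k) *\<^sub>R (inverse (b n k) *\<^sub>R (x - a n k)) + snd (w n k)" for x
          using assms(10)[of n k] by (simp add: w_def algebra_simps)
        then have "g k (S n k \<omega>') = iexp ((fst (w n k) *\<^sub>R t) \<bullet> (inverse (b n k) *\<^sub>R (S n k \<omega>' - a n k)))
            * iexp (t \<bullet> snd (w n k))" for \<omega>'
          unfolding g_def by (simp only: inner_add_right inner_scaleR_left inner_scaleR_right
              of_real_add distrib_left exp_add mult.left_commute)
        then show ?thesis
          unfolding mixture_kernel_def h_arr_def
          by (subst char_fun_distr) simp_all
      qed
      then show ?thesis by simp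
    qed
    finally show ?thesis .
  qed

  have tight_U: "uniformly_tight (\<lambda>n. distr M borel (U_seq n))"
    using assms(16) unfolding weakly_relatively_compact_def
    by (intro uniformly_tight_if_weakly_relatively_compact distr_prob) auto
  have scale_tight_M: "\<exists>K. \<forall>n. prob {\<omega>\<in>space M. K < \<bar>fst (w n (N n \<omega>))\<bar>} < \<epsilon>" if \<epsilon>: "\<epsilon> > 0" for \<epsilon>
  proof -
    obtain K where "\<And>n. measure (distr M borel (U_seq n)) {x. K < norm x} < \<epsilon>"
      using tight_U \<epsilon> unfolding uniformly_tight_def by blast
    moreover have "measure (distr M borel (U_seq n)) {x. K < norm x} = prob {\<omega>\<in>space M. K < \<bar>fst (w n (N n \<omega>))\<bar>}" for n
      by (subst measure_distr) (auto simp: U_eq W_eq scale_meas intro!: arg_cong[where f=prob])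
    ultimately show ?thesis by auto
  qed
  have scale_tight: "\<exists>K. \<forall>n. measure (\<kappa> n) {v. K < \<bar>fst v\<bar>} < \<epsilon>" if \<epsilon>: "\<epsilon> > 0" for \<epsilon>
  proof -
    have "{v :: real \<times> (real ^ 'm). K < \<bar>fst v\<bar>} \<in> sets borel" for K
      by (intro borel_open open_Collect_less continuous_intros)
    then have "measure (\<kappa> n) {v. K < \<bar>fst v\<bar>} = prob {\<omega>\<in>space M. K < \<bar>fst (w n (N n \<omega>))\<bar>}" for n K
      unfolding \<kappa>_def
      by (subst measure_distr) (auto simp: W_eq W_meas[unfolded W_eq] intro!: arg_cong[where f=prob])
    then show ?thesis
      using scale_tight_M[OF \<epsilon>] by simp
  qed

  have char_gap: "(\<lambda>n. char_fun (distr M borel (Z_seq n)) t - (CLINT v|\<kappa> n. mixture_kernel h t v)) \<longlonglongrightarrow> 0" for t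
  proof -
    have h_arr_bound: "norm (h_arr n k s) \<le> 1" for n k s
      unfolding h_arr_def by (intro norm_char_fun_le_1 distr_prob) measurable
    have "(CLINT v|\<kappa> n. mixture_kernel h t v) = (CLINT \<omega>|M. mixture_kernel h t (w n (N n \<omega>)))" for n
      using kernel_distr[OF W_meas, of n t] by (simp add: \<kappa>_def W_eq)
    then show ?thesis
      unfolding char_Z_seq
      using mixture_kernel_coherent_limit[OF N_meas h_arr_bound h_bound coherency scale_tight_M] by simp
  qed

  interpret \<Lambda>: Metric_space "space (prob_algebra borel)" \<Lambda>
    using assms(15) unfolding metrizes_weak_convergence_def by blast
  have metrizes: "(\<lambda>n. \<Lambda> (\<mu> n) \<nu>) \<longlonglongrightarrow> 0 \<longleftrightarrow> weakly_converges \<mu> \<nu>"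
    if "\<And>n. \<mu> n \<in> space (prob_algebra borel)" "\<nu> \<in> space (prob_algebra borel)" for \<mu> \<nu>
    using assms(15) that unfolding metrizes_weak_convergence_def by blast
  have mixing_meas: "X \<in> borel_measurable M" if "X \<in> mixing_vectors M Z Y" for X
    using that by (simp add: mixing_vectors_def)

  have squeeze: "f \<longlonglongrightarrow> 0" if "g \<longlonglongrightarrow> 0" "\<And>n. 0 \<le> f n" "\<And>n. f n \<le> g n" for f g :: "nat \<Rightarrow> real"
    using that by (intro real_tendsto_sandwich[of "\<lambda>_. 0" f sequentially g]) auto
  show ?thesis
  proof
    assume "converges_in_distribution M Z_seq Z"
    then have "weakly_converges (\<lambda>n. distr M borel (Z_seq n)) (distr M borel Z)"
      unfolding converges_in_distribution_def .
    then have char_Z: "(\<lambda>n. char_fun (distr M borel (Z_seq n)) t) \<longlonglongrightarrow> char_fun (distr M borel Z) t" for t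
      unfolding char_fun_def
      by (rule weakly_converges_complex[where B=1]) (auto intro: distr_prob continuous_iexp_inner)
    have kernel_Z: "(\<lambda>n. CLINT v|\<kappa> n. mixture_kernel h t v) \<longlonglongrightarrow> char_fun (distr M borel Z) t" for t
      using tendsto_diff[OF char_Z[of t] char_gap[of t]] by simp
    have tight: "uniformly_tight \<kappa>"
      by (rule uniformly_tight_mixing_laws[OF \<kappa>_prob Y_prob Z_prob scale_tight])
         (use kernel_Z in \<open>simp_all add: h_def\<close>)
    \<comment> \<open>Every limit point of the laws of \<open>W_n\<close> is the law of a mixing vector; the space \<open>M\<close> is rich enough
      to carry it.\<close>
    have limit_point: "\<exists>r. strict_mono r \<and> (\<exists>X\<in>mixing_vectors M Z Y.
        weakly_converges (\<lambda>j. \<kappa> (s (r j))) (distr M borel X))" if s: "strict_mono s" for s :: "nat \<Rightarrow> nat"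
    proof -
      have "uniformly_tight (\<lambda>j. \<kappa> (s j))"
        using tight unfolding uniformly_tight_def by blast
      then obtain r \<mu> where r: "strict_mono r" and \<mu>: "\<mu> \<in> space (prob_algebra borel)"
        and conv: "weakly_converges (\<lambda>j. \<kappa> (s (r j))) \<mu>"
        using Prokhorov_euclidean[of "\<lambda>j. \<kappa> (s j)"] \<kappa>_prob by blast
      obtain X where X: "X \<in> borel_measurable M" "distr M borel X = \<mu>"
        using assms(8) \<mu> unfolding rich_for_def by blast
      have "AE v in \<kappa> n. 0 \<le> fst v" for n
      proof -
        have "{v :: real \<times> (real ^ 'm). 0 \<le> fst v} \<in> sets borel"
          by (intro borel_closed closed_Collect_le continuous_intros)
        then have "(AE v in \<kappa> n. 0 \<le> fst v) \<longleftrightarrow> (AE \<omega> in M. 0 \<le> fst (W_seq n \<omega>))"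
          unfolding \<kappa>_def by (intro AE_distr_iff) auto
        then show ?thesis
          using assms(10,13) by (simp add: W_eq w_def less_imp_le)
      qed
      then have "AE v in \<mu>. 0 \<le> fst v"
        by (intro weak_limit_nonneg[OF \<kappa>_prob \<mu> conv])
      moreover have "(CLINT v|\<mu>. mixture_kernel h t v) = char_fun (distr M borel Z) t" for t
        using LIMSEQ_unique[OF kernel_limit[OF conv \<kappa>_prob \<mu>]]
          LIMSEQ_subseq_LIMSEQ[OF kernel_Z strict_mono_o[OF s r]] by (simp add: comp_def)
      ultimately have "X \<in> mixing_vectors M Z Y"
        unfolding mixing_iff[OF X(1)] X(2) by blast
      then show ?thesis
        using r conv X(2) by blast
    qed
    \<comment> \<open>The distance from the law of \<open>W_n\<close> to the laws of mixing vectors. It tends to 0 along a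
      subsequence of every subsequence, hence along the whole sequence.\<close>
    define dist_mixing where "dist_mixing n = (INF X\<in>mixing_vectors M Z Y. \<Lambda> (distr M borel X) (\<kappa> n))" for n
    have nonempty: "mixing_vectors M Z Y \<noteq> {}"
      using limit_point[OF strict_mono_id] by blast
    have bdd: "bdd_below ((\<lambda>X. \<Lambda> (distr M borel X) (\<kappa> n)) ` mixing_vectors M Z Y)" for n
      by (intro bdd_belowI2[where m=0] \<Lambda>.nonneg)
    have dist_mixing_nonneg: "0 \<le> dist_mixing n" for n
      unfolding dist_mixing_def by (intro cINF_greatest nonempty \<Lambda>.nonneg)
    have dist_mixing_0: "dist_mixing \<longlonglongrightarrow> 0"
    proof (rule tendsto_if_subseqs)
      fix s :: "nat \<Rightarrow> nat" assume "strict_mono s"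
      from limit_point[OF this] obtain r X where r: "strict_mono r" and X: "X \<in> mixing_vectors M Z Y"
        and conv: "weakly_converges (\<lambda>j. \<kappa> (s (r j))) (distr M borel X)" by blast
      have "(\<lambda>j. \<Lambda> (\<kappa> (s (r j))) (distr M borel X)) \<longlonglongrightarrow> 0"
        using conv metrizes[of "\<lambda>j. \<kappa> (s (r j))"] \<kappa>_prob distr_prob[OF mixing_meas[OF X]] by blast
      moreover have "dist_mixing (s (r j)) \<le> \<Lambda> (\<kappa> (s (r j))) (distr M borel X)" for j
        unfolding dist_mixing_def by (subst \<Lambda>.commute) (rule cINF_lower[OF bdd X])
      ultimately have "(\<lambda>j. dist_mixing (s (r j))) \<longlonglongrightarrow> 0"
        by (rule squeeze[OF _ dist_mixing_nonneg])
      with r show "\<exists>r. strict_mono r \<and> (\<lambda>j. dist_mixing (s (r j))) \<longlonglongrightarrow> 0"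
        by blast
    qed
    have "\<exists>X\<in>mixing_vectors M Z Y. \<Lambda> (distr M borel X) (\<kappa> n) < dist_mixing n + inverse (real (Suc n))" for n
      using cINF_less_iff[OF nonempty bdd, of n "dist_mixing n + inverse (real (Suc n))"]
      unfolding dist_mixing_def by simp
    then obtain W_star where W_star: "\<And>n. W_star n \<in> mixing_vectors M Z Y"
      and close: "\<And>n. \<Lambda> (distr M borel (W_star n)) (\<kappa> n) < dist_mixing n + inverse (real (Suc n))"
      by metis
    have star_prob: "distr M borel (W_star n) \<in> space (prob_algebra borel)" for n
      by (rule distr_prob[OF mixing_meas[OF W_star]])
    have "(\<lambda>n. dist_mixing n + inverse (real (Suc n))) \<longlonglongrightarrow> 0"
      using tendsto_add[OF dist_mixing_0 LIMSEQ_inverse_real_of_nat] by simp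
    then have star_close: "(\<lambda>n. \<Lambda> (distr M borel (W_star n)) (\<kappa> n)) \<longlonglongrightarrow> 0"
      using \<Lambda>.nonneg less_imp_le[OF close] by (rule squeeze)
    have "weakly_relatively_compact M W_star"
      unfolding weakly_relatively_compact_def
    proof
      fix s :: "nat \<Rightarrow> nat"
      obtain q :: "nat \<Rightarrow> nat" where q: "strict_mono q" "(\<exists>k. \<forall>j. s (q j) = k) \<or> strict_mono (s \<circ> q)"
        by (rule subseq_constant_or_strict_mono[of s]) (rule that; assumption)
      from q(2) show "\<exists>r. strict_mono r \<and> (\<exists>\<mu>\<in>space (prob_algebra borel).
          weakly_converges (\<lambda>j. distr M borel (W_star (s (r j)))) \<mu>)"
      proof
        assume "\<exists>k. \<forall>j. s (q j) = k"
        then obtain k where "\<And>j. s (q j) = k" by auto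
        then show ?thesis
          using q(1) star_prob[of k] weakly_converges_const[of "distr M borel (W_star k)"]
          by (intro exI[of _ q]) auto
      next
        assume sq: "strict_mono (s \<circ> q)"
        from limit_point[OF this] obtain r X where r: "strict_mono r" and X: "X \<in> mixing_vectors M Z Y"
          and conv: "weakly_converges (\<lambda>j. \<kappa> (s (q (r j)))) (distr M borel X)" by auto
        have X_prob: "distr M borel X \<in> space (prob_algebra borel)"
          by (rule distr_prob[OF mixing_meas[OF X]])
        have "(\<lambda>j. \<Lambda> (distr M borel (W_star (s (q (r j))))) (\<kappa> (s (q (r j))))
            + \<Lambda> (\<kappa> (s (q (r j)))) (distr M borel X)) \<longlonglongrightarrow> 0 + 0"
        proof (rule tendsto_add)
          show "(\<lambda>j. \<Lambda> (distr M borel (W_star (s (q (r j))))) (\<kappa> (s (q (r j))))) \<longlonglongrightarrow> 0"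
            using LIMSEQ_subseq_LIMSEQ[OF star_close strict_mono_o[OF sq r]] by (simp add: comp_def)
          show "(\<lambda>j. \<Lambda> (\<kappa> (s (q (r j)))) (distr M borel X)) \<longlonglongrightarrow> 0"
            using conv metrizes[of "\<lambda>j. \<kappa> (s (q (r j)))"] \<kappa>_prob X_prob by blast
        qed
        then have "(\<lambda>j. \<Lambda> (distr M borel (W_star (s (q (r j))))) (distr M borel X)) \<longlonglongrightarrow> 0"
          unfolding add_0
          by (rule squeeze) (intro \<Lambda>.nonneg \<Lambda>.triangle star_prob \<kappa>_prob X_prob)+
        then have "weakly_converges (\<lambda>j. distr M borel (W_star (s (q (r j))))) (distr M borel X)"
          using metrizes[of "\<lambda>j. distr M borel (W_star (s (q (r j))))"] star_prob X_prob by blast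
        then show ?thesis
          using strict_mono_o[OF q(1) r] X_prob by (intro exI[of _ "q \<circ> r"]) auto
      qed
    qed
    then show "\<exists>W_star. (\<forall>n. W_star n \<in> mixing_vectors M Z Y) \<and> weakly_relatively_compact M W_star \<and>
        (\<lambda>n. \<Lambda> (distr M borel (W_star n)) (distr M borel (W_seq n))) \<longlonglongrightarrow> 0"
      using W_star star_close unfolding \<kappa>_def by blast
  next
    assume "\<exists>W_star. (\<forall>n. W_star n \<in> mixing_vectors M Z Y) \<and> weakly_relatively_compact M W_star \<and>
        (\<lambda>n. \<Lambda> (distr M borel (W_star n)) (distr M borel (W_seq n))) \<longlonglongrightarrow> 0"
    then obtain W_star where W_star: "\<And>n. W_star n \<in> mixing_vectors M Z Y"
      and cpt: "weakly_relatively_compact M W_star"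
      and star_close: "(\<lambda>n. \<Lambda> (distr M borel (W_star n)) (\<kappa> n)) \<longlonglongrightarrow> 0"
      unfolding \<kappa>_def by blast
    have star_prob: "distr M borel (W_star n) \<in> space (prob_algebra borel)" for n
      by (rule distr_prob[OF mixing_meas[OF W_star]])
    have kernel_Z: "(\<lambda>n. CLINT v|\<kappa> n. mixture_kernel h t v) \<longlonglongrightarrow> char_fun (distr M borel Z) t" for t
    proof (rule tendsto_if_subseqs)
      fix s :: "nat \<Rightarrow> nat" assume s: "strict_mono s"
      obtain r \<mu> where r: "strict_mono r" and \<mu>: "\<mu> \<in> space (prob_algebra borel)"
        and star_conv: "weakly_converges (\<lambda>j. distr M borel (W_star (s (r j)))) \<mu>"
        using cpt unfolding weakly_relatively_compact_def by blast
      have "(\<lambda>j. \<Lambda> (distr M borel (W_star (s (r j)))) (\<kappa> (s (r j)))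
          + \<Lambda> (distr M borel (W_star (s (r j)))) \<mu>) \<longlonglongrightarrow> 0 + 0"
      proof (rule tendsto_add)
        show "(\<lambda>j. \<Lambda> (distr M borel (W_star (s (r j)))) (\<kappa> (s (r j)))) \<longlonglongrightarrow> 0"
          using LIMSEQ_subseq_LIMSEQ[OF star_close strict_mono_o[OF s r]] by (simp add: comp_def)
        show "(\<lambda>j. \<Lambda> (distr M borel (W_star (s (r j)))) \<mu>) \<longlonglongrightarrow> 0"
          using star_conv metrizes[of "\<lambda>j. distr M borel (W_star (s (r j)))"] star_prob \<mu> by blast
      qed
      then have "(\<lambda>j. \<Lambda> (\<kappa> (s (r j))) \<mu>) \<longlonglongrightarrow> 0"
        unfolding add_0
        by (rule squeeze) (intro \<Lambda>.nonneg \<Lambda>.triangle'' star_prob \<kappa>_prob \<mu>)+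
      then have "weakly_converges (\<lambda>j. \<kappa> (s (r j))) \<mu>"
        using metrizes[of "\<lambda>j. \<kappa> (s (r j))"] \<kappa>_prob \<mu> by blast
      from kernel_limit[OF this \<kappa>_prob \<mu>]
      have "(\<lambda>j. CLINT v|\<kappa> (s (r j)). mixture_kernel h t v) \<longlonglongrightarrow> (CLINT v|\<mu>. mixture_kernel h t v)" .
      moreover have "(CLINT v|\<mu>. mixture_kernel h t v) = char_fun (distr M borel Z) t"
      proof (rule LIMSEQ_unique)
        show "(\<lambda>j. CLINT v|distr M borel (W_star (s (r j))). mixture_kernel h t v)
            \<longlonglongrightarrow> (CLINT v|\<mu>. mixture_kernel h t v)"
          by (rule kernel_limit[OF star_conv star_prob \<mu>])
        show "(\<lambda>j. CLINT v|distr M borel (W_star (s (r j))). mixture_kernel h t v)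
            \<longlonglongrightarrow> char_fun (distr M borel Z) t"
          using W_star mixing_iff[OF mixing_meas[OF W_star]] by simp
      qed
      ultimately show "\<exists>r. strict_mono r \<and>
          (\<lambda>j. CLINT v|\<kappa> (s (r j)). mixture_kernel h t v) \<longlonglongrightarrow> char_fun (distr M borel Z) t"
        using r by auto
    qed
    have "(\<lambda>n. char_fun (distr M borel (Z_seq n)) t) \<longlonglongrightarrow> char_fun (distr M borel Z) t" for t
      using tendsto_add[OF char_gap[of t] kernel_Z[of t]] by simp
    then show "converges_in_distribution M Z_seq Z"
      unfolding converges_in_distribution_def
      by (intro levy_continuity_euclidean(2) distr_prob) auto
  qed
qed

end
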